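(* Let $S \subseteq \mathbb{Z}^n$, and let $T + G$ denote the Minkowski sum $\{t + g \mid t \in T, g \in G\}$. (1) If $S$ is L$^\natural$-convex, then $S = T + G$ for some bounded L$^\natural$-convex set $T$ and some conic L$^\natural$-convex set $G$. (2) If $S$ is L$^\natural_2$-convex, then $S = T + G$ for some bounded L$^\natural_2$-convex set $T$ and some conic L$^\natural_2$-convex set $G$. (3) If $S$ is M$^\natural$-convex, then $S = T + G$ for some bounded M$^\natural$-convex set $T$ and some conic M$^\natural$-convex set $G$. Similarly, if $S$ is M-convex, then $S = T + G$ for some bounded M-convex set $T$ and some conic M-convex set $G$. (4) If $S$ is M$^\natural_2$-convex, then $S = T + G$ for some bounded M$^\natural_2$-convex set $T$ and some conic M$^\natural_2$-convex set $G$. Similarly, if $S$ is M$_2$-convex, then $S = T + G$ for some bounded M$_2$-convex set $T$ and some conic M$_2$-convex set $G$. (5) If $S$ is multimodular, then $S = T + G$ for some bounded multimodular set $T$ and some conic multimodular set $G$.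
   Context: All sets below are nonempty subsets of $\mathbb{Z}^n$; $e_i$ denotes the $i$-th unit vector, and $\lceil\cdot\rceil$, $\lfloor\cdot\rfloor$ act componentwise. A set $S$ is L$^\natural$-convex if for all $p,q \in S$ both $\lceil (p+q)/2 \rceil$ and $\lfloor (p+q)/2 \rfloor$ belong to $S$. A set is L$^\natural_2$-convex if it is the Minkowski sum of two L$^\natural$-convex sets. A set $S$ is M$^\natural$-convex if for all $x,y \in S$ and every $i$ with $x_i > y_i$, either ($x - e_i \in S$ and $y + e_i \in S$) or there exists $j$ with $x_j < y_j$ such that $x - e_i + e_j \in S$ and $y + e_i - e_j \in S$. A set $S$ is M-convex if for all $x,y \in S$ and every $i$ with $x_i > y_i$ there exists $j$ with $x_j < y_j$ such that $x - e_i + e_j \in S$ and $y + e_i - e_j \in S$. A set is M$^\natural_2$-convex (resp. M$_2$-convex) if it is the intersection of two M$^\natural$-convex (resp. M-convex) sets. A set $S$ is multimodular if $S = \{Dy \mid y \in T\}$ for some L$^\natural$-convex set $T$, where $D$ is the $n\times n$ matrix with $D_{ii} = 1$, $D_{i+1,i} = -1$ and all other entries $0$. A set $G \subseteq \mathbb{Z}^n$ is conic if its convex hull is a cone (closed under multiplication by nonnegative scalars). Bounded means finite. *)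

theory Defs
  imports "HOL-Analysis.Analysis"
begin

text \<open>
  Points of \<open>\<int>\<^sup>n\<close> are vectors of type \<open>int ^ 'n\<close>.  All classes of sets below consist of nonempty
  sets.  Minkowski sums are the library's \<open>(+)\<close> on sets, and \<open>axis i 1\<close> is the \<open>i\<close>-th unit vector.
\<close>

definition Lnat_convex :: "(int ^ 'n) set \<Rightarrow> bool" where
  "Lnat_convex S \<longleftrightarrow> S \<noteq> {} \<and>
     (\<forall>p\<in>S. \<forall>q\<in>S.
        (\<chi> i. \<lceil>real_of_int (p $ i + q $ i) / 2\<rceil>) \<in> S \<and>
        (\<chi> i. \<lfloor>real_of_int (p $ i + q $ i) / 2\<rfloor>) \<in> S)"

definition L2nat_convex :: "(int ^ 'n) set \<Rightarrow> bool" where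
  "L2nat_convex S \<longleftrightarrow> (\<exists>A B. Lnat_convex A \<and> Lnat_convex B \<and> S = A + B)"

definition Mnat_convex :: "(int ^ 'n) set \<Rightarrow> bool" where
  "Mnat_convex S \<longleftrightarrow> S \<noteq> {} \<and>
     (\<forall>x\<in>S. \<forall>y\<in>S. \<forall>i. x $ i > y $ i \<longrightarrow>
        (x - axis i 1 \<in> S \<and> y + axis i 1 \<in> S) \<or>
        (\<exists>j. x $ j < y $ j \<and>
             x - axis i 1 + axis j 1 \<in> S \<and> y + axis i 1 - axis j 1 \<in> S))"

definition M_convex :: "(int ^ 'n) set \<Rightarrow> bool" where
  "M_convex S \<longleftrightarrow> S \<noteq> {} \<and>
     (\<forall>x\<in>S. \<forall>y\<in>S. \<forall>i. x $ i > y $ i \<longrightarrow>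
        (\<exists>j. x $ j < y $ j \<and>
             x - axis i 1 + axis j 1 \<in> S \<and> y + axis i 1 - axis j 1 \<in> S))"

definition M2nat_convex :: "(int ^ 'n) set \<Rightarrow> bool" where
  "M2nat_convex S \<longleftrightarrow> S \<noteq> {} \<and> (\<exists>A B. Mnat_convex A \<and> Mnat_convex B \<and> S = A \<inter> B)"

definition M2_convex :: "(int ^ 'n) set \<Rightarrow> bool" where
  "M2_convex S \<longleftrightarrow> S \<noteq> {} \<and> (\<exists>A B. M_convex A \<and> M_convex B \<and> S = A \<inter> B)"

text \<open>
  The position, in \<open>{1..n}\<close>, of an index with respect to the linear order on the index type.  It
  gives meaning to the row index \<open>i + 1\<close> in the definition of the matrix \<open>D\<close>.
\<close>

definition idx_pos :: "'n::{finite,linorder} \<Rightarrow> nat" where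
  "idx_pos i = card {j. j \<le> i}"

definition D_matrix :: "int ^ 'n::{finite,linorder} ^ 'n::{finite,linorder}" where
  "D_matrix = (\<chi> i j. if i = j then 1 else if idx_pos i = idx_pos j + 1 then -1 else 0)"

definition multimodular :: "(int ^ 'n::{finite,linorder}) set \<Rightarrow> bool" where
  "multimodular S \<longleftrightarrow> (\<exists>T. Lnat_convex T \<and> S = {D_matrix *v y | y. y \<in> T})"

text \<open>The convex hull is taken in \<open>\<real>\<^sup>n\<close>, after embedding \<open>\<int>\<^sup>n\<close> componentwise.\<close>

definition real_vec :: "int ^ 'n \<Rightarrow> real ^ 'n" where
  "real_vec x = (\<chi> i. real_of_int (x $ i))"

definition conic_set :: "(int ^ 'n) set \<Rightarrow> bool" where
  "conic_set G \<longleftrightarrow> cone (convex hull (real_vec ` G))"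

end

theory Submission
  imports Defs
begin

text \<open>
  The integer points of a polyhedron with integral data satisfy \<open>S = T + G\<close> with \<open>T\<close> finite and
  \<open>G\<close> the integer points of the recession cone: by Dickson's lemma, applied to the slacks, every
  sequence in \<open>S\<close> has a subsequence whose increments lie in \<open>G\<close>, so no sequence can avoid all
  translates by \<open>G\<close> of its earlier members. This subsequence property is inherited by
  intersections, and \<open>T\<close> may be enlarged to the intersection of \<open>S\<close> with a cube, which is
  of the same class as \<open>S\<close>. A set \<open>G\<close> that contains \<open>0\<close> and is closed under addition is automatically conic.

  For an L-natural-convex set the relevant inequalities bound single coordinates and differences of
  two coordinates. For an M-convex set, \<open>G\<close> is generated by the vectors \<open>e\<^sub>i - e\<^sub>j\<close> along which
  every point of \<open>S\<close> can be moved, and the inequalities bound the sums over the index sets that no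
  such move can increase; M-natural-convex sets are reduced to this case by adding a coordinate.
  L-natural-2-convex sets are treated summandwise, and multimodular sets are linear images.
\<close>

section \<open>Decomposition from well-quasi-ordered increments\<close>

definition submonoid :: "'a::monoid_add set \<Rightarrow> bool" where
  "submonoid G \<longleftrightarrow> 0 \<in> G \<and> (\<forall>a\<in>G. \<forall>b\<in>G. a + b \<in> G)"

lemma submonoid_Int: "submonoid G \<Longrightarrow> submonoid H \<Longrightarrow> submonoid (G \<inter> H)"
  by (auto simp: submonoid_def)

lemma submonoid_plus:
  fixes G H :: "'a::comm_monoid_add set"
  assumes "submonoid G" "submonoid H"
  shows "submonoid (G + H)"
  unfolding submonoid_def
proof (intro conjI ballI)
  show "0 \<in> G + H"
    using assms set_plus_intro[of 0 G 0 H] by (simp add: submonoid_def)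
  fix a b assume "a \<in> G + H" "b \<in> G + H"
  then obtain g h g' h' where *: "a = g + h" "b = g' + h'" "g \<in> G" "g' \<in> G" "h \<in> H" "h' \<in> H"
    by (meson set_plus_elim)
  then have "a + b = (g + g') + (h + h')" by (simp add: algebra_simps)
  then show "a + b \<in> G + H"
    using * assms by (auto simp: submonoid_def intro!: set_plus_intro)
qed

lemma real_vec_simps: "real_vec 0 = 0" "real_vec (x + y) = real_vec x + real_vec y"
  by (simp_all add: real_vec_def vec_eq_iff)

text \<open>For \<open>0 \<le> c \<le> k\<close> the point \<open>c x\<close> lies between \<open>0\<close> and \<open>k x\<close>, and \<open>k G \<subseteq> G\<close>.\<close>

lemma submonoid_conic:
  assumes "submonoid G"
  shows "conic_set G"
  unfolding conic_set_def cone_def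
proof (intro ballI allI impI)
  fix x :: "real^'a" and c :: real
  let ?H = "convex hull (real_vec ` G)"
  assume x: "x \<in> ?H" and c: "0 \<le> c"
  have zero: "0 \<in> ?H"
    using assms hull_inc[of "real_vec 0" "real_vec ` G" convex] imageI[of 0 G real_vec]
    by (simp add: submonoid_def real_vec_simps del: imageI)
  have mult: "real k *\<^sub>R g \<in> real_vec ` G" if "g \<in> real_vec ` G" for k g
  proof (induction k)
    case 0
    then show ?case
      using assms by (metis imageI mult_zero_left of_nat_0 real_vec_simps(1) scaleR_zero_left submonoid_def)
  next
    case (Suc k)
    then obtain a b where "real k *\<^sub>R g = real_vec a" "g = real_vec b" "a \<in> G" "b \<in> G"
      using \<open>g \<in> _\<close> by auto
    then have "real (Suc k) *\<^sub>R g = real_vec (a + b)" "a + b \<in> G"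
      using assms by (auto simp: real_vec_simps scaleR_left_distrib submonoid_def add.commute)
    then show ?case by simp
  qed
  obtain k :: nat where k: "c < k" using reals_Archimedean2 by blast
  have "real k *\<^sub>R x \<in> (*\<^sub>R) (real k) ` ?H" using x by (rule imageI)
  also have "\<dots> = convex hull ((*\<^sub>R) (real k) ` real_vec ` G)"
    by (metis convex_hull_scaling)
  also have "\<dots> \<subseteq> ?H" using mult by (intro hull_mono) auto
  finally have kx: "real k *\<^sub>R x \<in> ?H" .
  have "(1 - c/k) *\<^sub>R 0 + (c/k) *\<^sub>R (real k *\<^sub>R x) \<in> ?H"
    using c k zero kx by (intro convexD) auto
  then show "c *\<^sub>R x \<in> ?H" using c k by simp
qed

text \<open>The last clause says that \<open>y - x \<in> G\<close> is a well-quasi-order on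
  \<open>S\<close>. Asking for a whole subsequence instead of one good pair allows repeated
  extraction, as is done for intersections.\<close>

definition good_direction_set :: "'a::ab_group_add set \<Rightarrow> 'a set \<Rightarrow> bool" where
  "good_direction_set S G \<longleftrightarrow> submonoid G \<and> (\<forall>x\<in>S. \<forall>g\<in>G. x + g \<in> S) \<and>
     (\<forall>f :: nat \<Rightarrow> 'a. range f \<subseteq> S \<longrightarrow>
        (\<exists>\<phi> :: nat \<Rightarrow> nat. strict_mono \<phi> \<and> (\<forall>k l. k < l \<longrightarrow> f (\<phi> l) - f (\<phi> k) \<in> G)))"

lemma good_direction_set_subsequence:
  assumes "good_direction_set S G" "range f \<subseteq> S"
  obtains \<phi> :: "nat \<Rightarrow> nat"
  where "strict_mono \<phi>" "\<And>k l. k < l \<Longrightarrow> f (\<phi> l) - f (\<phi> k) \<in> G"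
  using assms unfolding good_direction_set_def by blast

lemma good_direction_set_Int:
  assumes A: "good_direction_set A G" and B: "good_direction_set B H"
  shows "good_direction_set (A \<inter> B) (G \<inter> H)"
  unfolding good_direction_set_def
proof (intro conjI allI impI)
  show "submonoid (G \<inter> H)"
    using A B submonoid_Int unfolding good_direction_set_def by blast
  show "\<forall>x\<in>A \<inter> B. \<forall>g\<in>G \<inter> H. x + g \<in> A \<inter> B"
    using A B unfolding good_direction_set_def by blast
  fix f :: "nat \<Rightarrow> 'a" assume f: "range f \<subseteq> A \<inter> B"
  then have "range f \<subseteq> A" by blast
  from good_direction_set_subsequence[OF A this] obtain \<phi> :: "nat \<Rightarrow> nat"
    where \<phi>: "strict_mono \<phi>" "\<And>k l. k < l \<Longrightarrow> f (\<phi> l) - f (\<phi> k) \<in> G" by blast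
  have "range (f \<circ> \<phi>) \<subseteq> B" using f by auto
  from good_direction_set_subsequence[OF B this] obtain \<psi> :: "nat \<Rightarrow> nat"
    where \<psi>: "strict_mono \<psi>" "\<And>k l. k < l \<Longrightarrow> (f \<circ> \<phi>) (\<psi> l) - (f \<circ> \<phi>) (\<psi> k) \<in> H" by blast
  have "strict_mono (\<phi> \<circ> \<psi>)" using \<phi> \<psi> by (simp add: strict_mono_o)
  moreover have "f ((\<phi> \<circ> \<psi>) l) - f ((\<phi> \<circ> \<psi>) k) \<in> G \<inter> H" if "k < l" for k l
    using \<phi>(2)[of "\<psi> k" "\<psi> l"] \<psi>(2)[OF that] strict_monoD[OF \<psi>(1) that] by simp
  ultimately show "\<exists>\<phi> :: nat \<Rightarrow> nat. strict_mono \<phi> \<and> (\<forall>k l. k < l \<longrightarrow> f (\<phi> l) - f (\<phi> k) \<in> G \<inter> H)"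
    by blast
qed

lemma good_direction_set_finite:
  assumes "good_direction_set S G"
  shows "\<exists>F. finite F \<and> F \<subseteq> S \<and> S \<subseteq> F + G"
proof (rule ccontr)
  assume neg: "\<not> ?thesis"
  have "\<exists>x. x \<in> S \<and> x \<notin> F + G" if "finite F" "F \<subseteq> S" for F
    using neg that by blast
  \<comment> \<open>\<open>c\<close> chooses, for each finite part of \<open>S\<close>, a point of
    \<open>S\<close> not yet covered; \<open>X\<close> collects these choices greedily.\<close>
  then obtain c where c: "\<And>F. finite F \<Longrightarrow> F \<subseteq> S \<Longrightarrow> c F \<in> S \<and> c F \<notin> F + G" by metis
  define X where "X = rec_nat {} (\<lambda>_ F. insert (c F) F)"
  have X: "X 0 = {}" "X (Suc n) = insert (c (X n)) (X n)" for n
    by (simp_all add: X_def)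
  have fin: "finite (X n) \<and> X n \<subseteq> S" for n
    by (induction n) (use c in \<open>auto simp: X\<close>)
  have "range (\<lambda>n. c (X n)) \<subseteq> S" using c fin by blast
  from good_direction_set_subsequence[OF assms this] obtain \<phi> :: "nat \<Rightarrow> nat"
    where \<phi>: "strict_mono \<phi>" "\<And>k l. k < l \<Longrightarrow> c (X (\<phi> l)) - c (X (\<phi> k)) \<in> G" by blast
  define a b where "a = \<phi> 0" and "b = \<phi> 1"
  have "a < b" using \<phi>(1) by (simp add: a_def b_def strict_mono_def)
  then have "c (X a) \<in> X b"
    by (induction b) (auto simp: X less_Suc_eq)
  moreover have "c (X b) - c (X a) \<in> G" using \<phi>(2)[of 0 1] by (simp add: a_def b_def)
  ultimately have "c (X a) + (c (X b) - c (X a)) \<in> X b + G" by (rule set_plus_intro)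
  then show False using c fin by simp
qed

text \<open>These are the products of integer intervals, bounded or not. Rounded midpoints and
  exchanges stay in the box spanned by the two given points, so they survive cutting with such a
  set. Unbounded boxes serve later to steer exchanges.\<close>

definition order_convex :: "(int ^ 'n) set \<Rightarrow> bool" where
  "order_convex B \<longleftrightarrow> (\<forall>x\<in>B. \<forall>y\<in>B. \<forall>z. (\<forall>k. min (x $ k) (y $ k) \<le> z $ k \<and> z $ k \<le> max (x $ k) (y $ k))
      \<longrightarrow> z \<in> B)"

lemma order_convexD:
  assumes "order_convex B" "x \<in> B" "y \<in> B"
    "\<And>k. min (x $ k) (y $ k) \<le> z $ k \<and> z $ k \<le> max (x $ k) (y $ k)"
  shows "z \<in> B"
  using assms unfolding order_convex_def by blast

lemma finite_cube: "finite {x :: int ^ 'n. \<forall>k. \<bar>x $ k\<bar> \<le> b}"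
proof -
  have "finite ((\<lambda>f. vec_lambda f :: int ^ 'n) ` (\<Pi>\<^sub>E k\<in>UNIV. {-b..b}))"
    by (intro finite_imageI finite_PiE) auto
  moreover have "{x :: int ^ 'n. \<forall>k. \<bar>x $ k\<bar> \<le> b} \<subseteq> (\<lambda>f. vec_lambda f) ` (\<Pi>\<^sub>E k\<in>UNIV. {-b..b})"
  proof
    fix x :: "int ^ 'n" assume "x \<in> {x. \<forall>k. \<bar>x $ k\<bar> \<le> b}"
    then have "vec_nth x \<in> (\<Pi>\<^sub>E k\<in>UNIV. {-b..b})" by (auto simp: abs_le_iff minus_le_iff)
    then show "x \<in> (\<lambda>f. vec_lambda f) ` (\<Pi>\<^sub>E k\<in>UNIV. {-b..b})"
      by (metis imageI vec_lambda_eta)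
  qed
  ultimately show ?thesis by (rule rev_finite_subset)
qed

lemma bounded_decomposition:
  fixes S G :: "(int ^ 'n) set"
  assumes good: "good_direction_set S G" and "S \<noteq> {}"
  shows "\<exists>B. order_convex B \<and> finite B \<and> S \<inter> B \<noteq> {} \<and> S = (S \<inter> B) + G"
proof -
  obtain F where F: "finite F" "F \<subseteq> S" "S \<subseteq> F + G"
    using good_direction_set_finite[OF good] by blast
  \<comment> \<open>The cube only has to contain the finite set \<open>F\<close>; inserting 0 makes
    this the maximum of a nonempty set.\<close>
  define b where "b = Max (insert 0 ((\<lambda>(x, k). \<bar>x $ k\<bar>) ` (F \<times> UNIV)))"
  define B where "B = {x :: int ^ 'n. \<forall>k. \<bar>x $ k\<bar> \<le> b}"
  have "\<bar>x $ k\<bar> \<le> b" if "x \<in> F" for x k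
    unfolding b_def using F that by (intro Max_ge) auto
  then have FB: "F \<subseteq> S \<inter> B" using F by (auto simp: B_def)
  have "order_convex B"
    unfolding order_convex_def B_def
  proof (intro ballI allI impI CollectI)
    fix x y z :: "int ^ 'n" and k
    assume "x \<in> {x. \<forall>k. \<bar>x $ k\<bar> \<le> b}" "y \<in> {x. \<forall>k. \<bar>x $ k\<bar> \<le> b}"
      "\<forall>k. min (x $ k) (y $ k) \<le> z $ k \<and> z $ k \<le> max (x $ k) (y $ k)"
    then have "\<bar>x $ k\<bar> \<le> b" "\<bar>y $ k\<bar> \<le> b" "min (x $ k) (y $ k) \<le> z $ k" "z $ k \<le> max (x $ k) (y $ k)"
      by auto
    then show "\<bar>z $ k\<bar> \<le> b" by linarith
  qed
  moreover have "finite B" unfolding B_def by (rule finite_cube)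
  moreover have "S \<subseteq> (S \<inter> B) + G" using F(3) FB set_plus_mono2[of F "S \<inter> B" G G] by blast
  moreover have "(S \<inter> B) + G \<subseteq> S"
    using good unfolding good_direction_set_def by (auto elim!: set_plus_elim)
  ultimately show ?thesis using FB \<open>S \<noteq> {}\<close> by (metis subset_antisym ex_in_conv set_plus_elim)
qed

text \<open>Dickson's lemma, by refining the subsequence for one functional at a time: a further
  subsequence keeps the earlier functionals nonincreasing.\<close>

lemma common_decseq_subsequence:
  fixes h :: "'r \<Rightarrow> 'a \<Rightarrow> int" and f :: "nat \<Rightarrow> 'a"
  assumes "finite R" and upper: "\<And>r. r \<in> R \<Longrightarrow> \<exists>b. \<forall>x\<in>S. h r x \<le> b" and f: "range f \<subseteq> S"
  shows "\<exists>\<phi> :: nat \<Rightarrow> nat. strict_mono \<phi> \<and> (\<forall>r\<in>R. \<forall>k l. k < l \<longrightarrow> h r (f (\<phi> l)) \<le> h r (f (\<phi> k)))"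
  using assms(1,2)
proof (induction R)
  case empty
  show ?case by (rule exI[of _ id]) (simp add: strict_mono_def)
next
  case (insert r R)
  then have "\<exists>\<phi> :: nat \<Rightarrow> nat. strict_mono \<phi> \<and> (\<forall>r\<in>R. \<forall>k l. k < l \<longrightarrow> h r (f (\<phi> l)) \<le> h r (f (\<phi> k)))"
    by simp
  then obtain \<phi> :: "nat \<Rightarrow> nat" where \<phi>: "strict_mono \<phi>"
    "\<And>s k l. s \<in> R \<Longrightarrow> k < l \<Longrightarrow> h s (f (\<phi> l)) \<le> h s (f (\<phi> k))" by blast
  obtain b where b: "\<And>x. x \<in> S \<Longrightarrow> h r x \<le> b" using insert.prems by blast
  define g where "g n = h r (f (\<phi> n))" for n
  have gb: "g n \<le> b" for n using b f by (auto simp: g_def)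
  obtain \<psi> where \<psi>: "strict_mono \<psi>" "monoseq (g \<circ> \<psi>)"
    using seq_monosub[of g] by (auto simp: comp_def)
  have "\<exists>\<theta> :: nat \<Rightarrow> nat. strict_mono \<theta> \<and> (\<forall>k l. k < l \<longrightarrow> g (\<psi> (\<theta> l)) \<le> g (\<psi> (\<theta> k)))"
  proof (cases "decseq (g \<circ> \<psi>)")
    case True
    then show ?thesis
      by (intro exI[of _ id]) (auto simp: strict_mono_def monotone_def)
  next
    case False
    with \<psi>(2) have inc: "incseq (g \<circ> \<psi>)" by (simp add: monoseq_iff)
    \<comment> \<open>An increasing integer sequence bounded by \<open>b\<close> attains its
      maximum, namely where the slack \<open>b - g\<close> is least; from there on it is
      constant.\<close>
    obtain n0 where n0: "\<And>n. g (\<psi> n) \<le> g (\<psi> n0)"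
    proof -
      obtain n0 where "\<forall>n. nat (b - g (\<psi> n0)) \<le> nat (b - g (\<psi> n))"
        using ex_has_least_nat[of "\<lambda>_. True" 0 "\<lambda>n. nat (b - g (\<psi> n))"] by auto
      then have "nat (b - g (\<psi> n0)) \<le> nat (b - g (\<psi> n))" for n by blast
      then have "b - g (\<psi> n0) \<le> b - g (\<psi> n)" for n
        using gb[of "\<psi> n"] by (metis diff_ge_0_iff_ge nat_le_eq_zle)
      then have "g (\<psi> n) \<le> g (\<psi> n0)" for n by (simp add: algebra_simps)
      then show thesis by (rule that)
    qed
    then have "g (\<psi> (l + n0)) \<le> g (\<psi> (k + n0))" for k l
      using incseqD[OF inc, of n0 "k + n0"] by (auto intro: order_trans[OF n0])
    then show ?thesis by (intro exI[of _ "\<lambda>k. k + n0"]) (auto simp: strict_mono_def)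
  qed
  then obtain \<theta> :: "nat \<Rightarrow> nat" where \<theta>: "strict_mono \<theta>" "\<And>k l. k < l \<Longrightarrow> g (\<psi> (\<theta> l)) \<le> g (\<psi> (\<theta> k))" by blast
  have mono: "strict_mono (\<psi> \<circ> \<theta>)" using \<psi>(1) \<theta>(1) by (simp add: strict_mono_o)
  have "h s (f (\<phi> (\<psi> (\<theta> l)))) \<le> h s (f (\<phi> (\<psi> (\<theta> k))))" if "s \<in> insert r R" "k < l" for s k l
    using that \<phi>(2)[of s "\<psi> (\<theta> k)" "\<psi> (\<theta> l)"] \<theta>(2)[of k l] strict_monoD[OF mono, of k l]
    by (auto simp: g_def)
  moreover have "strict_mono (\<phi> \<circ> (\<psi> \<circ> \<theta>))" using \<phi>(1) mono by (simp add: strict_mono_o)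
  ultimately show ?case by (intro exI[of _ "\<phi> \<circ> (\<psi> \<circ> \<theta>)"]) (simp add: comp_def)
qed

section \<open>L-natural-convex sets\<close>

lemma ceiling_floor_half:
  fixes a :: int
  shows "\<lceil>real_of_int a / 2\<rceil> = (a + 1) div 2" "\<lfloor>real_of_int a / 2\<rfloor> = a div 2"
proof -
  show "\<lfloor>real_of_int a / 2\<rfloor> = a div 2" using floor_divide_of_int_eq[of a 2] by simp
  have "\<lceil>real_of_int a / 2\<rceil> = - \<lfloor>real_of_int (- a) / 2\<rfloor>"
    by (simp add: ceiling_def)
  also have "\<dots> = - ((- a) div 2)" using floor_divide_of_int_eq[of "- a" 2] by simp
  also have "\<dots> = (a + 1) div 2" by presburger
  finally show "\<lceil>real_of_int a / 2\<rceil> = (a + 1) div 2" .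
qed

lemma Lnat_convex_iff:
  "Lnat_convex S \<longleftrightarrow> S \<noteq> {} \<and> (\<forall>p\<in>S. \<forall>q\<in>S.
     (\<chi> i. (p $ i + q $ i + 1) div 2) \<in> S \<and> (\<chi> i. (p $ i + q $ i) div 2) \<in> S)"
  unfolding Lnat_convex_def ceiling_floor_half ..

lemma Lnat_convex_Int_order_convex:
  assumes "Lnat_convex S" "order_convex B" "S \<inter> B \<noteq> {}"
  shows "Lnat_convex (S \<inter> B)"
  unfolding Lnat_convex_iff
proof (intro conjI ballI IntI)
  fix p q assume *: "p \<in> S \<inter> B" "q \<in> S \<inter> B"
  then show "(\<chi> i. (p $ i + q $ i + 1) div 2) \<in> S" "(\<chi> i. (p $ i + q $ i) div 2) \<in> S"
    using assms(1) by (auto simp: Lnat_convex_iff)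
  show "(\<chi> i. (p $ i + q $ i + 1) div 2) \<in> B" "(\<chi> i. (p $ i + q $ i) div 2) \<in> B"
    using * by (auto intro!: order_convexD[OF assms(2), of p q])
qed (use assms in auto)

text \<open>Negation swaps rounding up and rounding down, which reduces minima to maxima.\<close>

lemma Lnat_convex_uminus:
  assumes "Lnat_convex S"
  shows "Lnat_convex (uminus ` S)"
proof -
  have "(\<chi> i. (- (p $ i) - q $ i + 1) div 2) = - (\<chi> i. (p $ i + q $ i) div 2)"
    "(\<chi> i. (- (p $ i) - q $ i) div 2) = - (\<chi> i. (p $ i + q $ i + 1) div 2)" for p q :: "int ^ 'a"
    by (simp_all add: vec_eq_iff) (presburger | intro allI)+
  then show ?thesis using assms unfolding Lnat_convex_iff by auto
qed

text \<open>Halving \<open>q - p\<close> repeatedly with rounding up ends in the indicator vector of \<open>{i. p\<^sub>i < q\<^sub>i}\<close>.\<close>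

lemma Lnat_convex_step:
  assumes S: "Lnat_convex S" and "p \<in> S" "q \<in> S"
  shows "(\<chi> i. if p $ i < q $ i then p $ i + 1 else p $ i) \<in> S"
  using \<open>q \<in> S\<close>
proof (induction "\<Sum>i\<in>UNIV. nat \<bar>q $ i - p $ i\<bar>" arbitrary: q rule: less_induct)
  case less
  define r where "r = (\<chi> i. (p $ i + q $ i + 1) div 2)"
  have r: "r \<in> S" using S \<open>p \<in> S\<close> less.prems by (simp add: Lnat_convex_iff r_def)
  have same: "p $ i < r $ i \<longleftrightarrow> p $ i < q $ i" for i by (auto simp: r_def)
  have le: "\<bar>r $ i - p $ i\<bar> \<le> \<bar>q $ i - p $ i\<bar>" for i by (simp add: r_def)
  show ?case
  proof (cases "\<exists>i. \<bar>r $ i - p $ i\<bar> < \<bar>q $ i - p $ i\<bar>")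
    case True
    then have "\<exists>i\<in>UNIV. nat \<bar>r $ i - p $ i\<bar> < nat \<bar>q $ i - p $ i\<bar>"
      by (metis UNIV_I abs_ge_zero nat_less_eq_zless)
    then have "(\<Sum>i\<in>UNIV. nat \<bar>r $ i - p $ i\<bar>) < (\<Sum>i\<in>UNIV. nat \<bar>q $ i - p $ i\<bar>)"
      using le by (intro sum_strict_mono_ex1) (auto simp: nat_mono)
    from less.hyps[OF this r] show ?thesis by (simp add: same)
  next
    case False
    \<comment> \<open>With d = q_i - p_i, the halving replaces d by d/2 rounded up, which has the
      same absolute value only for d = 0 and d = 1; so \<open>q\<close> is already the
      target.\<close>
    have "(\<chi> i. if p $ i < q $ i then p $ i + 1 else p $ i) = q"
      unfolding vec_eq_iff
    proof
      fix i
      have "\<bar>r $ i - p $ i\<bar> = \<bar>q $ i - p $ i\<bar>" using False le[of i] by (metis order.order_iff_strict)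
      then show "(\<chi> i. if p $ i < q $ i then p $ i + 1 else p $ i) $ i = q $ i"
        by (simp add: r_def) presburger
    qed
    then show ?thesis using less.prems by simp
  qed
qed

text \<open>Repeated with \<open>q\<close> fixed, the step lemma raises exactly the coordinates
  still below \<open>q\<close>, so \<open>p\<close> climbs to the maximum.\<close>

lemma Lnat_convex_sup:
  assumes S: "Lnat_convex S" and "p \<in> S" "q \<in> S"
  shows "(\<chi> i. max (p $ i) (q $ i)) \<in> S"
  using \<open>p \<in> S\<close>
proof (induction "\<Sum>i\<in>UNIV. nat (q $ i - p $ i)" arbitrary: p rule: less_induct)
  case less
  show ?case
  proof (cases "\<exists>i. p $ i < q $ i")
    case True
    define r where "r = (\<chi> i. if p $ i < q $ i then p $ i + 1 else p $ i)"
    have r: "r \<in> S" unfolding r_def using Lnat_convex_step[OF S less.prems \<open>q \<in> S\<close>] .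
    have "(\<Sum>i\<in>UNIV. nat (q $ i - r $ i)) < (\<Sum>i\<in>UNIV. nat (q $ i - p $ i))"
      using True by (intro sum_strict_mono_ex1) (auto simp: r_def)
    from less.hyps[OF this r] have "(\<chi> i. max (r $ i) (q $ i)) \<in> S" .
    moreover have "(\<chi> i. max (r $ i) (q $ i)) = (\<chi> i. max (p $ i) (q $ i))"
      by (auto simp: vec_eq_iff r_def max_def)
    ultimately show ?thesis by simp
  next
    case False
    then have "(\<chi> i. max (p $ i) (q $ i)) = p"
      by (auto simp: vec_eq_iff max_def not_less antisym)
    then show ?thesis using less.prems by simp
  qed
qed

lemma Lnat_convex_inf:
  assumes S: "Lnat_convex S" and "p \<in> S" "q \<in> S"
  shows "(\<chi> i. min (p $ i) (q $ i)) \<in> S"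
proof -
  have "(\<chi> i. max ((- p) $ i) ((- q) $ i)) \<in> uminus ` S"
    using assms by (intro Lnat_convex_sup Lnat_convex_uminus) auto
  then obtain r where r: "r \<in> S" "(\<chi> i. max (- p $ i) (- q $ i)) = - r" by auto
  from r(2) have "(\<chi> i. min (p $ i) (q $ i)) = r"
    by (simp add: vec_eq_iff) (metis minus_max_eq_min minus_minus)
  then show ?thesis using r by simp
qed

text \<open>Bounds on single coordinates of \<open>S\<close> become bounds on differences of two coordinates.\<close>

definition homogenize :: "(int ^ 'n) set \<Rightarrow> (int ^ 'n option) set" where
  "homogenize S = {x. (\<chi> i. x $ Some i - x $ None) \<in> S}"

lemma homogenize_shift: "x \<in> homogenize S \<Longrightarrow> (\<chi> k. x $ k + c) \<in> homogenize S"
  by (simp add: homogenize_def)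

text \<open>If the two \<open>None\<close> coordinates have an even sum, each rounded midpoint maps
  to the corresponding one in \<open>S\<close>; if the sum is odd, rounding up and rounding down are
  interchanged.\<close>

lemma Lnat_convex_homogenize:
  assumes S: "Lnat_convex S"
  shows "Lnat_convex (homogenize S)"
  unfolding Lnat_convex_iff
proof (intro conjI ballI)
  obtain s where "s \<in> S" using S by (auto simp: Lnat_convex_def)
  then have "(\<chi> k. case k of None \<Rightarrow> 0 | Some i \<Rightarrow> s $ i) \<in> homogenize S"
    by (simp add: homogenize_def)
  then show "homogenize S \<noteq> {}" by blast
next
  fix x y assume *: "x \<in> homogenize S" "y \<in> homogenize S"
  define p q where "p = (\<chi> i. x $ Some i - x $ None)" and "q = (\<chi> i. y $ Some i - y $ None)"
  have S': "(\<chi> i. (p $ i + q $ i + 1) div 2) \<in> S" "(\<chi> i. (p $ i + q $ i) div 2) \<in> S"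
    using * S unfolding homogenize_def Lnat_convex_iff p_def q_def by blast+
  have sum: "x $ Some i + y $ Some i = p $ i + q $ i + (x $ None + y $ None)" for i
    by (simp add: p_def q_def)
  show "(\<chi> i. (x $ i + y $ i + 1) div 2) \<in> homogenize S" "(\<chi> i. (x $ i + y $ i) div 2) \<in> homogenize S"
  proof (atomize (full), cases "even (x $ None + y $ None)")
    case True
    then obtain c where c: "x $ None + y $ None = 2 * c" by (elim evenE)
    have "(a + b + 2 * c + 1) div 2 - (2 * c + 1) div 2 = (a + b + 1) div 2"
      "(a + b + 2 * c) div 2 - (2 * c) div 2 = (a + b) div 2" for a b by presburger+
    then show "(\<chi> i. (x $ i + y $ i + 1) div 2) \<in> homogenize S \<and> (\<chi> i. (x $ i + y $ i) div 2) \<in> homogenize S"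
      using S' by (simp add: homogenize_def sum c)
  next
    case False
    then obtain c where c: "x $ None + y $ None = 2 * c + 1" by (elim oddE)
    have "(a + b + (2 * c + 1) + 1) div 2 - (2 * c + 1 + 1) div 2 = (a + b) div 2"
      "(a + b + (2 * c + 1)) div 2 - (2 * c + 1) div 2 = (a + b + 1) div 2" for a b by presburger+
    then show "(\<chi> i. (x $ i + y $ i + 1) div 2) \<in> homogenize S \<and> (\<chi> i. (x $ i + y $ i) div 2) \<in> homogenize S"
      using S' by (simp add: homogenize_def sum c)
  qed
qed

text \<open>Witnesses for single pairs are shifted to agree with \<open>q\<close> at
  \<open>i\<close> and joined by maxima into a point above \<open>q\<close> that still agrees at
  \<open>i\<close>; the minimum of these points over all \<open>i\<close> is
  \<open>q\<close>.\<close>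

lemma homogenize_mem_if_differences:
  assumes S: "Lnat_convex S"
    and diff: "\<And>i j. \<exists>p\<in>homogenize S. q $ j - q $ i \<le> p $ j - p $ i"
  shows "q \<in> homogenize S"
proof -
  let ?H = "homogenize S"
  note H = Lnat_convex_homogenize[OF S]
  have above: "\<exists>p\<in>?H. p $ i = q $ i \<and> (\<forall>j\<in>J. q $ j \<le> p $ j)" if "finite J" for i J
    using that
  proof (induction J)
    case empty
    obtain p where "p \<in> ?H" using diff by blast
    then show ?case using homogenize_shift[of p S "q $ i - p $ i"]
      by (intro bexI[of _ "\<chi> k. p $ k + (q $ i - p $ i)"]) auto
  next
    case (insert j J)
    then obtain p where p: "p \<in> ?H" "p $ i = q $ i" "\<And>j. j \<in> J \<Longrightarrow> q $ j \<le> p $ j" by blast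
    obtain r where r: "r \<in> ?H" "q $ j - q $ i \<le> r $ j - r $ i" using diff by blast
    define s where "s = (\<chi> k. r $ k + (q $ i - r $ i))"
    have "s \<in> ?H" unfolding s_def by (rule homogenize_shift[OF r(1)])
    then have "(\<chi> k. max (p $ k) (s $ k)) \<in> ?H" by (rule Lnat_convex_sup[OF H p(1)])
    then show ?case using p r
      by (intro bexI[of _ "\<chi> k. max (p $ k) (s $ k)"]) (auto simp: s_def le_max_iff_disj)
  qed
  have "\<exists>p\<in>?H. (\<forall>j. q $ j \<le> p $ j) \<and> (\<forall>i\<in>I. p $ i = q $ i)" if "finite I" for I
    using that
  proof (induction I)
    case empty
    then show ?case using above[of UNIV] by auto
  next
    case (insert i I)
    then obtain p where p: "p \<in> ?H" "\<And>j. q $ j \<le> p $ j" "\<And>i. i \<in> I \<Longrightarrow> p $ i = q $ i" by blast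
    obtain r where r: "r \<in> ?H" "r $ i = q $ i" "\<And>j. q $ j \<le> r $ j" using above[of UNIV i] by auto
    have "(\<chi> k. min (p $ k) (r $ k)) \<in> ?H" by (rule Lnat_convex_inf[OF H p(1) r(1)])
    then show ?case using p r
      by (intro bexI[of _ "\<chi> k. min (p $ k) (r $ k)"]) (auto simp: min_absorb1 min_absorb2)
  qed
  from this[of UNIV] show ?thesis by (auto simp: vec_eq_iff[symmetric])
qed

lemma Lnat_convex_good_direction_set:
  assumes S: "Lnat_convex S"
  shows "\<exists>G. Lnat_convex G \<and> good_direction_set S G"
proof -
  define ext :: "int ^ 'a \<Rightarrow> int ^ 'a option"
    where "ext x = (\<chi> k. case k of None \<Rightarrow> 0 | Some i \<Rightarrow> x $ i)" for x
  have ext: "ext x \<in> homogenize S \<longleftrightarrow> x \<in> S" for x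
    by (simp add: homogenize_def ext_def)
  have ext_add: "ext (x + y) = ext x + ext y" "ext (x - y) = ext x - ext y" for x y
    by (simp_all add: ext_def vec_eq_iff split: option.split)
  \<comment> \<open>The differences bounded above cut out the recession cone \<open>G\<close>. Since
    \<open>ext\<close> puts 0 at \<open>None\<close>, bounds on single coordinates are
    included.\<close>
  define R where "R = {(i, j). \<exists>b. \<forall>x\<in>homogenize S. x $ j - x $ i \<le> b}"
  define G where "G = {g. \<forall>(i, j)\<in>R. ext g $ j \<le> ext g $ i}"
  have ext_mid: "ext (\<chi> i. (p $ i + q $ i + 1) div 2) $ k = (ext p $ k + ext q $ k + 1) div 2"
    "ext (\<chi> i. (p $ i + q $ i) div 2) $ k = (ext p $ k + ext q $ k) div 2" for p q k
    by (simp_all add: ext_def split: option.split)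
  have "Lnat_convex G"
    unfolding Lnat_convex_iff
  proof (intro conjI ballI)
    have "0 \<in> G" by (auto simp: G_def ext_def split: option.split)
    then show "G \<noteq> {}" by blast
  next
    fix p q assume "p \<in> G" "q \<in> G"
    then show "(\<chi> i. (p $ i + q $ i + 1) div 2) \<in> G" "(\<chi> i. (p $ i + q $ i) div 2) \<in> G"
      unfolding G_def by (auto simp: ext_mid intro!: zdiv_mono1 add_mono)
  qed
  moreover have "good_direction_set S G"
    unfolding good_direction_set_def
  proof (intro conjI ballI allI impI)
    show "submonoid G"
      unfolding submonoid_def G_def
      by (force simp: ext_add intro: add_mono simp: ext_def split: option.split)
  next
    fix x g assume x: "x \<in> S" and g: "g \<in> G"
    have "ext (x + g) \<in> homogenize S"
    proof (rule homogenize_mem_if_differences[OF S])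
      fix i j
      show "\<exists>p\<in>homogenize S. ext (x + g) $ j - ext (x + g) $ i \<le> p $ j - p $ i"
      \<comment> \<open>For pairs in \<open>R\<close> the difference does not grow in direction
        \<open>g\<close>, so \<open>x\<close> is a witness; for the others unboundedness provides
        one.\<close>
      proof (cases "(i, j) \<in> R")
        case True
        then have "ext g $ j \<le> ext g $ i" using g by (auto simp: G_def)
        then show ?thesis using x by (intro bexI[of _ "ext x"]) (auto simp: ext ext_add)
      next
        case False
        then have "\<not> (\<forall>y\<in>homogenize S. y $ j - y $ i \<le> ext (x + g) $ j - ext (x + g) $ i)"
          by (auto simp: R_def)
        then show ?thesis by (meson linear)
      qed
    qed
    then show "x + g \<in> S" by (simp add: ext)
  next
    fix f :: "nat \<Rightarrow> int ^ 'a" assume f: "range f \<subseteq> S"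
    have "\<exists>\<phi> :: nat \<Rightarrow> nat. strict_mono \<phi> \<and> (\<forall>r\<in>R. \<forall>k l. k < l \<longrightarrow>
        (\<lambda>(i, j) x. ext x $ j - ext x $ i) r (f (\<phi> l)) \<le> (\<lambda>(i, j) x. ext x $ j - ext x $ i) r (f (\<phi> k)))"
    proof (rule common_decseq_subsequence[OF _ _ f])
      show "\<exists>b. \<forall>x\<in>S. (\<lambda>(i, j) x. ext x $ j - ext x $ i) r x \<le> b" if "r \<in> R" for r
        using that ext by (fastforce simp: R_def)
    qed simp
    then show "\<exists>\<phi> :: nat \<Rightarrow> nat. strict_mono \<phi> \<and> (\<forall>k l. k < l \<longrightarrow> f (\<phi> l) - f (\<phi> k) \<in> G)"
      by (fastforce simp: G_def ext_add)
  qed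
  ultimately show ?thesis by blast
qed

section \<open>Sets with the weak exchange property\<close>

definition unit_diff :: "'v \<Rightarrow> 'v \<Rightarrow> int ^ 'v" where
  "unit_diff i j = axis i 1 - axis j 1"

lemma unit_diff_nth: "unit_diff i j $ k = (if k = i then 1 else 0) - (if k = j then 1 else 0)"
  by (simp add: unit_diff_def axis_def)

lemma unit_diff_self [simp]: "unit_diff i i = 0"
  by (simp add: unit_diff_def)

lemma unit_diff_trans: "unit_diff i j + unit_diff j k = unit_diff i k"
  by (simp add: unit_diff_def)

lemma sum_unit_diff:
  fixes I :: "'v::finite set"
  shows "(\<Sum>k\<in>I. unit_diff i j $ k) = (if i \<in> I then 1 else 0) - (if j \<in> I then 1 else 0)"
  by (simp add: unit_diff_nth sum_subtractf)

definition vdist :: "int ^ 'v \<Rightarrow> int ^ 'v \<Rightarrow> nat" where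
  "vdist x y = (\<Sum>k\<in>UNIV. nat \<bar>x $ k - y $ k\<bar>)"

lemma vdist_commute: "vdist x y = vdist y x"
  by (simp add: vdist_def abs_minus_commute)

lemma vdist_step:
  assumes "y $ i < x $ i" "x $ j < y $ j"
  shows "vdist (x + unit_diff j i) y < vdist x y"
  unfolding vdist_def
proof (rule sum_strict_mono_ex1)
  show "\<forall>k\<in>UNIV. nat \<bar>(x + unit_diff j i) $ k - y $ k\<bar> \<le> nat \<bar>x $ k - y $ k\<bar>"
    using assms by (auto simp: unit_diff_nth)
  have "i \<noteq> j" using assms by auto
  then show "\<exists>k\<in>UNIV. nat \<bar>(x + unit_diff j i) $ k - y $ k\<bar> < nat \<bar>x $ k - y $ k\<bar>"
    using assms by (intro bexI[of _ i]) (auto simp: unit_diff_nth)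
qed simp

text \<open>Unlike the exchange axiom of M-convexity, the index \<open>j\<close> may differ for the two conclusions.
  The liftings of M-natural-convex sets are easily seen to have this weaker property.\<close>

definition weak_exchange :: "(int ^ 'v) set \<Rightarrow> bool" where
  "weak_exchange S \<longleftrightarrow>
     (\<forall>x\<in>S. \<forall>y\<in>S. (\<Sum>k\<in>UNIV. x $ k) = (\<Sum>k\<in>UNIV. y $ k)) \<and>
     (\<forall>x\<in>S. \<forall>y\<in>S. \<forall>i. y $ i < x $ i \<longrightarrow>
        (\<exists>j. x $ j < y $ j \<and> x + unit_diff j i \<in> S) \<and>
        (\<exists>j. x $ j < y $ j \<and> y + unit_diff i j \<in> S))"

lemma weak_exchange_sum_eq:
  "weak_exchange S \<Longrightarrow> x \<in> S \<Longrightarrow> y \<in> S \<Longrightarrow> (\<Sum>k\<in>UNIV. x $ k) = (\<Sum>k\<in>UNIV. y $ k)"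
  unfolding weak_exchange_def by blast

lemma weak_exchange_down:
  assumes "weak_exchange S" "x \<in> S" "y \<in> S" "y $ i < x $ i"
  obtains j where "x $ j < y $ j" "x + unit_diff j i \<in> S"
  using assms unfolding weak_exchange_def by blast

lemma weak_exchange_up:
  assumes "weak_exchange S" "x \<in> S" "y \<in> S" "y $ i < x $ i"
  obtains j where "x $ j < y $ j" "y + unit_diff i j \<in> S"
  using assms unfolding weak_exchange_def by blast

text \<open>Every coordinate changed by an exchange moves towards the other point, so the result
  stays in the box spanned by \<open>x\<close> and \<open>y\<close>.\<close>

lemma weak_exchange_Int_order_convex:
  assumes S: "weak_exchange S" and B: "order_convex B"
  shows "weak_exchange (S \<inter> B)"
  unfolding weak_exchange_def
proof (intro conjI ballI allI impI)
  fix x y assume x: "x \<in> S \<inter> B" and y: "y \<in> S \<inter> B"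
  then show "(\<Sum>k\<in>UNIV. x $ k) = (\<Sum>k\<in>UNIV. y $ k)" using weak_exchange_sum_eq[OF S] by blast
  fix i assume i: "y $ i < x $ i"
  from x y i obtain j where j: "x $ j < y $ j" "x + unit_diff j i \<in> S"
    using weak_exchange_down[OF S] by blast
  have "x + unit_diff j i \<in> B"
    using x y i j by (auto intro!: order_convexD[OF B, of x y] simp: unit_diff_nth)
  with j show "\<exists>j. x $ j < y $ j \<and> x + unit_diff j i \<in> S \<inter> B" by blast
  from x y i obtain l where l: "x $ l < y $ l" "y + unit_diff i l \<in> S"
    using weak_exchange_up[OF S] by blast
  have "y + unit_diff i l \<in> B"
    using x y i l by (auto intro!: order_convexD[OF B, of x y] simp: unit_diff_nth)
  with l show "\<exists>j. x $ j < y $ j \<and> y + unit_diff i j \<in> S \<inter> B" by blast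
qed

text \<open>Take a point closest to \<open>x\<close> among those whose sum over \<open>I\<close> is at least that of \<open>y\<close>; an
  exchange against \<open>x\<close> in a wrongly signed coordinate would bring it closer.\<close>

lemma weak_exchange_dominate:
  fixes S :: "(int ^ 'v) set"
  assumes S: "weak_exchange S" and x: "x \<in> S" and y: "y \<in> S"
  obtains z where "z \<in> S" "(\<Sum>k\<in>I. y $ k) \<le> (\<Sum>k\<in>I. z $ k)"
    "\<And>k. k \<in> I \<Longrightarrow> x $ k \<le> z $ k" "\<And>k. k \<notin> I \<Longrightarrow> z $ k \<le> x $ k"
proof -
  let ?P = "\<lambda>z. z \<in> S \<and> (\<Sum>k\<in>I. y $ k) \<le> (\<Sum>k\<in>I. z $ k)"
  obtain z where z: "?P z" and least: "\<And>w. ?P w \<Longrightarrow> vdist z x \<le> vdist w x"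
    using ex_has_least_nat[of ?P y "\<lambda>z. vdist z x"] y by blast
  have sum: "(\<Sum>k\<in>I. (z + unit_diff i j) $ k)
      = (\<Sum>k\<in>I. z $ k) + (if i \<in> I then 1 else 0) - (if j \<in> I then 1 else 0)" for i j
    by (simp add: sum.distrib sum_unit_diff)
  have "x $ k \<le> z $ k" if "k \<in> I" for k
  proof (rule ccontr)
    assume "\<not> x $ k \<le> z $ k"
    then obtain j where j: "x $ j < z $ j" "z + unit_diff k j \<in> S"
      using weak_exchange_up[OF S x conjunct1[OF z], of k] by auto
    then have "vdist (z + unit_diff k j) x < vdist z x"
      using vdist_step[of x j z k] \<open>\<not> x $ k \<le> z $ k\<close> by simp
    moreover have "?P (z + unit_diff k j)" using z j that by (simp only: sum) simp
    ultimately show False using least by (meson not_le)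
  qed
  moreover have "z $ k \<le> x $ k" if "k \<notin> I" for k
  proof (rule ccontr)
    assume "\<not> z $ k \<le> x $ k"
    then obtain j where j: "z $ j < x $ j" "z + unit_diff j k \<in> S"
      using weak_exchange_down[OF S conjunct1[OF z] x, of k] by auto
    then have "vdist (z + unit_diff j k) x < vdist z x"
      using vdist_step[of x k z j] \<open>\<not> z $ k \<le> x $ k\<close> by simp
    moreover have "?P (z + unit_diff j k)" using z j that by (simp only: sum) simp
    ultimately show False using least by (meson not_le)
  qed
  ultimately show thesis using z that by blast
qed

lemma eq_plus_multiple_unit_diff:
  fixes x u :: "int ^ 'v"
  assumes sum: "(\<Sum>k\<in>UNIV. u $ k) = (\<Sum>k\<in>UNIV. x $ k)" and "i \<noteq> j"
    and eq: "\<And>k. k \<noteq> i \<Longrightarrow> k \<noteq> j \<Longrightarrow> u $ k = x $ k"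
  shows "u = x + (x $ j - u $ j) *s unit_diff i j"
proof -
  have "0 = (\<Sum>k\<in>UNIV. u $ k - x $ k)" using sum by (simp add: sum_subtractf)
  also have "\<dots> = (\<Sum>k\<in>{i, j}. u $ k - x $ k)"
    using eq by (intro sum.mono_neutral_right) auto
  finally have "u $ i - x $ i = x $ j - u $ j" using \<open>i \<noteq> j\<close> by simp
  then show ?thesis using eq \<open>i \<noteq> j\<close> by (auto simp: vec_eq_iff unit_diff_nth)
qed

text \<open>When the farther point is exchanged against \<open>x\<close> at \<open>i\<close>, its
  only coordinate below \<open>x\<close> is \<open>j\<close>, so the exchange steps back along the
  ray.\<close>

lemma weak_exchange_descend:
  assumes S: "weak_exchange S" and "x \<in> S" "i \<noteq> j"
  shows "x + int (m + n) *s unit_diff i j \<in> S \<Longrightarrow> x + int m *s unit_diff i j \<in> S"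
proof (induction n)
  case (Suc n)
  let ?u = "x + int (m + Suc n) *s unit_diff i j"
  have "x $ i < ?u $ i" using \<open>i \<noteq> j\<close> by (simp add: unit_diff_nth)
  with Suc.prems obtain k where k: "?u $ k < x $ k" "?u + unit_diff k i \<in> S"
    using weak_exchange_down[OF S _ \<open>x \<in> S\<close>] by blast
  then have "k = j" by (auto simp: unit_diff_nth split: if_splits)
  moreover have "?u + unit_diff j i = x + int (m + n) *s unit_diff i j"
    by (simp add: vec_eq_iff unit_diff_nth)
  ultimately show ?case using k Suc.IH by metis
qed simp

text \<open>Compared with \<open>x\<close>, the point \<open>w\<close> may lose at many coordinates
  in favour of \<open>i\<close>; here the transfer from \<open>j\<close> alone is isolated.\<close>

lemma weak_exchange_unit_diff_multiple:
  fixes x :: "int ^ 'v"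
  assumes S: "weak_exchange S" and x: "x \<in> S" and w: "w \<in> S"
    and le: "\<And>k. k \<noteq> i \<Longrightarrow> w $ k \<le> x $ k" and "i \<noteq> j" and m: "int m \<le> x $ j - w $ j"
  shows "x + int m *s unit_diff i j \<in> S"
proof -
  \<comment> \<open>\<open>B\<close> prevents gains outside \<open>i\<close>, and domination on the
    complement of \<open>{j}\<close> prevents losses outside \<open>j\<close>; so \<open>u\<close>
    differs from \<open>x\<close> at most at \<open>i\<close> and \<open>j\<close>.\<close>
  define B where "B = {u. \<forall>k. k \<noteq> i \<longrightarrow> u $ k \<le> x $ k}"
  have "order_convex B" by (auto simp: order_convex_def B_def) (metis max.bounded_iff max_def order_trans)
  then have SB: "weak_exchange (S \<inter> B)" by (rule weak_exchange_Int_order_convex[OF S])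
  have "x \<in> S \<inter> B" "w \<in> S \<inter> B" using x w le by (auto simp: B_def)
  from weak_exchange_dominate[OF SB this, of "- {j}"] obtain u where
    u: "u \<in> S \<inter> B" "(\<Sum>k\<in>-{j}. w $ k) \<le> (\<Sum>k\<in>-{j}. u $ k)" "\<And>k. k \<noteq> j \<Longrightarrow> x $ k \<le> u $ k"
    by auto
  have "(\<Sum>k\<in>UNIV. v $ k) = v $ j + (\<Sum>k\<in>-{j}. v $ k)" for v :: "int ^ 'v"
    by (simp add: sum.remove[of UNIV j] Compl_eq_Diff_UNIV)
  \<comment> \<open>Totals being equal, a lower bound for the sum off \<open>j\<close> is an upper
    bound at \<open>j\<close>.\<close>
  then have "u $ j \<le> w $ j" using u(2) weak_exchange_sum_eq[OF S w, of u] u(1) by simp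
  have "u = x + (x $ j - u $ j) *s unit_diff i j"
    using u weak_exchange_sum_eq[OF S x, of u] \<open>i \<noteq> j\<close>
    by (intro eq_plus_multiple_unit_diff) (auto simp: B_def intro: antisym)
  moreover obtain n where "x $ j - u $ j = int (m + n)"
    using m \<open>u $ j \<le> w $ j\<close> by (metis add.commute diff_left_mono of_nat_add order_trans zle_iff_zadd)
  ultimately have "x + int (m + n) *s unit_diff i j \<in> S" using u(1) by auto
  then show ?thesis using weak_exchange_descend[OF S x \<open>i \<noteq> j\<close>] by blast
qed

lemma ex_gt_if_sum_gt:
  fixes f :: "'v::finite \<Rightarrow> int"
  assumes "int CARD('v) * K < sum f I" "0 \<le> K"
  shows "\<exists>i\<in>I. K < f i"
proof (rule ccontr)
  assume "\<not> ?thesis"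
  then have "sum f I \<le> (\<Sum>i\<in>I. K)" by (intro sum_mono) auto
  also have "\<dots> = int (card I) * K" by simp
  also have "\<dots> \<le> int CARD('v) * K" using assms(2) by (intro mult_right_mono) (auto intro: card_mono)
  finally show False using assms(1) by simp
qed

section \<open>Free arcs and bounded sums over closed sets\<close>

definition free_arcs :: "(int ^ 'v) set \<Rightarrow> ('v \<times> 'v) set" where
  "free_arcs S = {(i, j). \<forall>x\<in>S. x + unit_diff i j \<in> S}"

lemma free_arcs_refl: "(i, i) \<in> free_arcs S"
  by (simp add: free_arcs_def)

lemma free_arcs_trans: "(i, j) \<in> free_arcs S \<Longrightarrow> (j, k) \<in> free_arcs S \<Longrightarrow> (i, k) \<in> free_arcs S"
  by (simp add: free_arcs_def) (metis add.assoc add.commute unit_diff_trans)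

text \<open>One ray from one point frees the arc at every point \<open>z\<close> of
  \<open>S\<close>: compare \<open>z\<close> with a point far out on the ray.\<close>

lemma free_arc_if_unbounded_ray:
  fixes S :: "(int ^ 'v) set"
  assumes S: "weak_exchange S" and "i \<noteq> j" and ray: "\<And>m. x + int m *s unit_diff i j \<in> S"
  shows "(i, j) \<in> free_arcs S"
  unfolding free_arcs_def
proof (clarify)
  fix z assume z: "z \<in> S"
  define D where "D = (\<Sum>k\<in>UNIV. \<bar>z $ k - x $ k\<bar>)"
  \<comment> \<open>\<open>M\<close> makes \<open>y\<close> exceed \<open>z\<close> at
    \<open>i\<close> by more than \<open>D\<close>. The coordinates other than \<open>i\<close> and
    \<open>j\<close> can contribute at most \<open>D\<close> to such a gain, so at least one unit
    comes from \<open>j\<close>.\<close>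
  define M where "M = nat (D + \<bar>x $ i - z $ i\<bar> + 1)"
  have "0 \<le> D" by (simp add: D_def sum_nonneg)
  define y where "y = x + int M *s unit_diff i j"
  have y: "y \<in> S" "y $ i = x $ i + int M" "\<And>k. k \<noteq> i \<Longrightarrow> k \<noteq> j \<Longrightarrow> y $ k = x $ k"
    using ray \<open>i \<noteq> j\<close> by (auto simp: y_def unit_diff_nth)
  define B where "B = {w. \<forall>k. min (y $ k) (z $ k) \<le> w $ k}"
  have "order_convex B" by (auto simp: order_convex_def B_def) (meson min.boundedI order_trans)
  then have SB: "weak_exchange (S \<inter> B)" by (rule weak_exchange_Int_order_convex[OF S])
  have "z \<in> S \<inter> B" "y \<in> S \<inter> B" using z y by (auto simp: B_def)
  from weak_exchange_dominate[OF SB this, of "{i}"] obtain w where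
    w: "w \<in> S \<inter> B" "y $ i \<le> w $ i" "\<And>k. k \<noteq> i \<Longrightarrow> w $ k \<le> z $ k" by auto
  have "w $ i - z $ i = (\<Sum>k\<in>-{i}. z $ k - w $ k)"
  proof -
    have "(\<Sum>k\<in>UNIV. v $ k) = v $ i + (\<Sum>k\<in>-{i}. v $ k)" for v :: "int ^ 'v"
      by (simp add: sum.remove[of UNIV i] Compl_eq_Diff_UNIV)
    then show ?thesis using weak_exchange_sum_eq[OF S z, of w] w(1) by (simp add: sum_subtractf)
  qed
  also have "\<dots> = (z $ j - w $ j) + (\<Sum>k\<in>-{i}-{j}. z $ k - w $ k)"
    using \<open>i \<noteq> j\<close> by (subst sum.remove[of _ j]) auto
  also have "(\<Sum>k\<in>-{i}-{j}. z $ k - w $ k) \<le> (\<Sum>k\<in>-{i}-{j}. \<bar>z $ k - x $ k\<bar>)"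
  proof (rule sum_mono)
    fix k assume "k \<in> -{i}-{j}"
    then have "y $ k = x $ k" using y(3) by simp
    moreover have "min (y $ k) (z $ k) \<le> w $ k" using w(1) unfolding B_def by blast
    ultimately show "z $ k - w $ k \<le> \<bar>z $ k - x $ k\<bar>" by linarith
  qed
  also have "\<dots> \<le> D" unfolding D_def by (rule sum_mono2) auto
  finally have "w $ i - z $ i \<le> z $ j - w $ j + D" by simp
  then have "int 1 \<le> z $ j - w $ j" using w(2) y(2) \<open>0 \<le> D\<close> by (simp add: M_def)
  then have "z + int 1 *s unit_diff i j \<in> S"
    using w by (intro weak_exchange_unit_diff_multiple[OF S z _ _ \<open>i \<noteq> j\<close>]) auto
  then show "z + unit_diff i j \<in> S" by simp
qed

text \<open>If every \<open>a\<close> failed from some \<open>N a\<close> on, then all would fail at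
  the sum of the \<open>N a\<close>.\<close>

lemma finite_antimono_choice:
  assumes "finite A" and ex: "\<And>M :: nat. \<exists>a\<in>A. P a M"
    and mono: "\<And>a M N. P a N \<Longrightarrow> M \<le> N \<Longrightarrow> P a M"
  shows "\<exists>a\<in>A. \<forall>M. P a M"
proof (rule ccontr)
  assume "\<not> ?thesis"
  then obtain N where N: "\<And>a. a \<in> A \<Longrightarrow> \<not> P a (N a)" by metis
  obtain a where a: "a \<in> A" "P a (\<Sum>a\<in>A. N a)" using ex by blast
  then show False using N mono[OF a(2), of "N a"] member_le_sum[of a A N] \<open>finite A\<close> by auto
qed

text \<open>Arbitrarily large gains on \<open>I\<close> must be paid for outside \<open>I\<close>.
  Two pigeonhole steps concentrate gain and loss on one arc leaving \<open>I\<close>; by finiteness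
  one such arc has an unbounded ray, hence is free.\<close>

lemma closed_set_sum_bounded:
  fixes S :: "(int ^ 'v) set"
  assumes S: "weak_exchange S" and closed: "\<And>i j. i \<in> I \<Longrightarrow> (i, j) \<in> free_arcs S \<Longrightarrow> j \<in> I"
  shows "\<exists>b. \<forall>x\<in>S. (\<Sum>k\<in>I. x $ k) \<le> b"
proof (rule ccontr)
  assume unbounded: "\<not> ?thesis"
  then obtain x where x: "x \<in> S" by blast
  let ?c = "int CARD('v)"
  define B where "B = {w. (\<forall>k\<in>I. x $ k \<le> w $ k) \<and> (\<forall>k. k \<notin> I \<longrightarrow> w $ k \<le> x $ k)}"
  have "order_convex B"
    unfolding order_convex_def
  proof (intro ballI allI impI)
    fix u v w :: "int ^ 'v"
    assume *: "u \<in> B" "v \<in> B" "\<forall>k. min (u $ k) (v $ k) \<le> w $ k \<and> w $ k \<le> max (u $ k) (v $ k)"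
    have "x $ k \<le> w $ k" if "k \<in> I" for k
    proof -
      have "x $ k \<le> min (u $ k) (v $ k)" using *(1,2) that by (auto simp: B_def)
      then show ?thesis using *(3) order_trans by blast
    qed
    moreover have "w $ k \<le> x $ k" if "k \<notin> I" for k
    proof -
      have "max (u $ k) (v $ k) \<le> x $ k" using *(1,2) that by (auto simp: B_def)
      then show ?thesis using *(3) order_trans by blast
    qed
    ultimately show "w \<in> B" by (simp add: B_def)
  qed
  then have SB: "weak_exchange (S \<inter> B)" by (rule weak_exchange_Int_order_convex[OF S])
  have xB: "x \<in> S \<inter> B" using x by (simp add: B_def)
  have "\<exists>p\<in>I \<times> (-I). x + int m *s unit_diff (fst p) (snd p) \<in> S" for m
  proof -
    \<comment> \<open>Each pigeonhole step, first for \<open>i\<close> in \<open>I\<close>, then for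
      \<open>j\<close> outside, costs a factor \<open>?c\<close>.\<close>
    obtain y where y: "y \<in> S" "(\<Sum>k\<in>I. x $ k) + ?c * (?c * int m) < (\<Sum>k\<in>I. y $ k)"
      using unbounded not_le by blast
    from weak_exchange_dominate[OF S x y(1), of I] obtain z where "z \<in> S"
      and le: "(\<Sum>k\<in>I. y $ k) \<le> (\<Sum>k\<in>I. z $ k)"
      and "\<And>k. k \<in> I \<Longrightarrow> x $ k \<le> z $ k" "\<And>k. k \<notin> I \<Longrightarrow> z $ k \<le> x $ k" by blast
    then have z: "z \<in> S \<inter> B" by (auto simp: B_def)
    have "?c * (?c * int m) < (\<Sum>k\<in>I. z $ k - x $ k)"
      using y le by (simp add: sum_subtractf)
    then have "\<exists>i\<in>I. ?c * int m < z $ i - x $ i" by (rule ex_gt_if_sum_gt) simp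
    then obtain i where i: "i \<in> I" "?c * int m < z $ i - x $ i" ..
    from weak_exchange_dominate[OF SB xB z(1), of "{i}"] obtain w where
      w: "w \<in> S \<inter> B" "z $ i \<le> w $ i" "\<And>k. k \<noteq> i \<Longrightarrow> w $ k \<le> x $ k" by auto
    \<comment> \<open>\<open>B\<close> keeps \<open>w\<close> at least \<open>x\<close> on
      \<open>I\<close>, and domination keeps it at most \<open>x\<close> off \<open>i\<close>;
      within \<open>I\<close> only coordinate \<open>i\<close> can change.\<close>
    have "w $ k = x $ k" if "k \<in> I" "k \<noteq> i" for k
      using w(1,3) that by (auto simp: B_def intro: antisym)
    then have "(\<Sum>k\<in>I. w $ k - x $ k) = w $ i - x $ i"
      using i(1) by (subst sum.remove[of _ i]) auto
    moreover have "(\<Sum>k\<in>I. w $ k - x $ k) = (\<Sum>k\<in>-I. x $ k - w $ k)"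
    proof -
      have "(\<Sum>k\<in>UNIV. v $ k) = (\<Sum>k\<in>I. v $ k) + (\<Sum>k\<in>-I. v $ k)" for v :: "int ^ 'v"
        by (subst sum.union_disjoint[symmetric]) auto
      then show ?thesis using weak_exchange_sum_eq[OF S x, of w] w(1) by (simp add: sum_subtractf)
    qed
    ultimately have "?c * int m < (\<Sum>k\<in>-I. x $ k - w $ k)" using i(2) w(2) by simp
    then have "\<exists>j\<in>-I. int m < x $ j - w $ j" by (rule ex_gt_if_sum_gt) simp
    then obtain j where j: "j \<in> -I" "int m < x $ j - w $ j" ..
    have "x + int m *s unit_diff i j \<in> S"
      using w i j by (intro weak_exchange_unit_diff_multiple[OF S x, of w]) auto
    then show ?thesis using i(1) j(1) by (intro bexI[of _ "(i, j)"]) auto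
  qed
  then have "\<exists>p\<in>I \<times> (-I). \<forall>m. x + int m *s unit_diff (fst p) (snd p) \<in> S"
  proof (rule finite_antimono_choice[rotated])
    show "finite (I \<times> (-I))" by simp
  next
    fix p and M N :: nat
    assume *: "x + int N *s unit_diff (fst p) (snd p) \<in> S" "M \<le> N"
    show "x + int M *s unit_diff (fst p) (snd p) \<in> S"
    proof (cases "fst p = snd p")
      case True
      then show ?thesis using x by simp
    next
      case False
      then show ?thesis using weak_exchange_descend[OF S x False, of M "N - M"] * by simp
    qed
  qed
  then obtain i j where "i \<in> I" "j \<notin> I" "\<And>m. x + int m *s unit_diff i j \<in> S" by auto
  then show False using closed[of i j] free_arc_if_unbounded_ray[OF S, of i j x] by metis
qed

section \<open>Cones generated by differences of unit vectors\<close>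

text \<open>The number of summands is recorded as the induction measure for the exchange
  property.\<close>

inductive arc_sum :: "('v \<times> 'v) set \<Rightarrow> nat \<Rightarrow> int ^ 'v \<Rightarrow> bool" for E where
  zero: "arc_sum E 0 0"
| add: "arc_sum E n x \<Longrightarrow> (i, j) \<in> E \<Longrightarrow> arc_sum E (Suc n) (x + unit_diff i j)"

definition arc_cone :: "('v \<times> 'v) set \<Rightarrow> (int ^ 'v) set" where
  "arc_cone E = {x. \<exists>n. arc_sum E n x}"

lemma arc_cone_zero: "0 \<in> arc_cone E"
  by (auto simp: arc_cone_def intro: arc_sum.zero)

lemma arc_cone_add_arc: "x \<in> arc_cone E \<Longrightarrow> (i, j) \<in> E \<Longrightarrow> x + unit_diff i j \<in> arc_cone E"
  by (auto simp: arc_cone_def intro: arc_sum.add)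

lemma arc_sum_add: "arc_sum E n y \<Longrightarrow> x \<in> arc_cone E \<Longrightarrow> x + y \<in> arc_cone E"
  by (induction rule: arc_sum.induct) (auto simp: add.assoc[symmetric] intro: arc_cone_add_arc)

lemma submonoid_arc_cone: "submonoid (arc_cone E)"
  unfolding submonoid_def using arc_sum_add arc_cone_zero by (fastforce simp: arc_cone_def)

text \<open>A last summand that is not of the required form does not raise coordinate
  \<open>i\<close>, so the coordinate was positive before it and the summand sought occurs
  earlier.\<close>

lemma arc_sum_pos:
  assumes "arc_sum E n x" "0 < x $ i"
  obtains a m where "n = Suc m" "(i, a) \<in> E" "i \<noteq> a" "arc_sum E m (x - unit_diff i a)"
  using assms
proof (induction arbitrary: thesis rule: arc_sum.induct)
  case (add n x p q)
  show thesis
  proof (cases "p = i \<and> q \<noteq> i")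
    case True
    then show thesis using add by auto
  next
    case False
    then have "0 < x $ i" using add.prems(2) by (auto simp: unit_diff_nth split: if_splits)
    then obtain a m where a: "n = Suc m" "(i, a) \<in> E" "i \<noteq> a" "arc_sum E m (x - unit_diff i a)"
      using add.IH by blast
    have "arc_sum E n ((x - unit_diff i a) + unit_diff p q)"
      unfolding a(1) by (rule arc_sum.add[OF a(4) add.hyps(2)])
    then show thesis using add.prems(1) a by (simp add: algebra_simps)
  qed
qed simp

lemma arc_sum_neg:
  assumes "arc_sum E n x" "x $ i < 0"
  obtains b m where "n = Suc m" "(b, i) \<in> E" "i \<noteq> b" "arc_sum E m (x - unit_diff b i)"
  using assms
proof (induction arbitrary: thesis rule: arc_sum.induct)
  case (add n x p q)
  show thesis
  proof (cases "q = i \<and> p \<noteq> i")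
    case True
    then show thesis using add by auto
  next
    case False
    then have "x $ i < 0" using add.prems(2) by (auto simp: unit_diff_nth split: if_splits)
    then obtain b m where b: "n = Suc m" "(b, i) \<in> E" "i \<noteq> b" "arc_sum E m (x - unit_diff b i)"
      using add.IH by blast
    have "arc_sum E n ((x - unit_diff b i) + unit_diff p q)"
      unfolding b(1) by (rule arc_sum.add[OF b(4) add.hyps(2)])
    then show thesis using add.prems(1) b by (simp add: algebra_simps)
  qed
qed simp

text \<open>If \<open>x\<^sub>i > y\<^sub>i\<close> then \<open>x\<close> has a summand \<open>e\<^sub>i - e\<^sub>a\<close> or \<open>y\<close> has a summand \<open>e\<^sub>b - e\<^sub>i\<close>.
  Removing it either gives the exchange or moves the excess to its other end.\<close>

lemma arc_cone_exchange:
  assumes "arc_sum E m x" "arc_sum E n y" "y $ i < x $ i"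
  shows "\<exists>j. x $ j < y $ j \<and> x + unit_diff j i \<in> arc_cone E \<and> y + unit_diff i j \<in> arc_cone E"
  using assms
proof (induction "m + n" arbitrary: m n x y i rule: less_induct)
  case less
  have xy: "x \<in> arc_cone E" "y \<in> arc_cone E" using less.prems by (auto simp: arc_cone_def)
  consider "0 < x $ i" | "y $ i < 0" using less.prems(3) by linarith
  then show ?case
  proof cases
    case 1
    then obtain a m' where a: "m = Suc m'" "(i, a) \<in> E" "i \<noteq> a" "arc_sum E m' (x - unit_diff i a)"
      using arc_sum_pos[OF less.prems(1)] by blast
    show ?thesis
    proof (cases "x $ a < y $ a")
      case True
      have "x - unit_diff i a \<in> arc_cone E" using a(4) by (auto simp: arc_cone_def)
      then have "x + unit_diff a i \<in> arc_cone E" by (simp add: unit_diff_def algebra_simps)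
      then show ?thesis using True xy a(2) arc_cone_add_arc by blast
    next
      case False
      then have "y $ a < (x - unit_diff i a) $ a" using a(3) by (simp add: unit_diff_nth)
      then obtain j where j: "(x - unit_diff i a) $ j < y $ j"
        "x - unit_diff i a + unit_diff j a \<in> arc_cone E" "y + unit_diff a j \<in> arc_cone E"
        using less.hyps[OF _ a(4) less.prems(2), of a] a(1) by auto
      \<comment> \<open>Removing the arc lowers \<open>x\<close> only at \<open>i\<close>, where it
        stays at least \<open>y $ i\<close>, so \<open>j \<noteq> i\<close>. Adding the arc to
        \<open>y + unit_diff a j\<close> then completes the exchange.\<close>
      have "x $ j < y $ j"
        using j(1) False less.prems(3) by (auto simp: unit_diff_nth split: if_splits)
      moreover have "x - unit_diff i a + unit_diff j a = x + unit_diff j i"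
        by (simp add: unit_diff_def)
      moreover have "y + unit_diff a j + unit_diff i a = y + unit_diff i j"
        by (simp add: unit_diff_def)
      ultimately show ?thesis using j arc_cone_add_arc[OF j(3) a(2)] by metis
    qed
  next
    case 2
    then obtain b n' where b: "n = Suc n'" "(b, i) \<in> E" "i \<noteq> b" "arc_sum E n' (y - unit_diff b i)"
      using arc_sum_neg[OF less.prems(2)] by blast
    show ?thesis
    proof (cases "x $ b < y $ b")
      case True
      have "y - unit_diff b i \<in> arc_cone E" using b(4) by (auto simp: arc_cone_def)
      then have "y + unit_diff i b \<in> arc_cone E" by (simp add: unit_diff_def algebra_simps)
      then show ?thesis using True xy b(2) arc_cone_add_arc by blast
    next
      case False
      then have "(y - unit_diff b i) $ b < x $ b" using b(3) by (simp add: unit_diff_nth)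
      then obtain j where j: "x $ j < (y - unit_diff b i) $ j"
        "x + unit_diff j b \<in> arc_cone E" "y - unit_diff b i + unit_diff b j \<in> arc_cone E"
        using less.hyps[OF _ less.prems(1) b(4), of b] b(1) by auto
      have "x $ j < y $ j"
        using j(1) False less.prems(3) by (auto simp: unit_diff_nth split: if_splits)
      moreover have "x + unit_diff j b + unit_diff b i = x + unit_diff j i"
        by (simp add: unit_diff_def)
      moreover have "y - unit_diff b i + unit_diff b j = y + unit_diff i j"
        by (simp add: unit_diff_def)
      ultimately show ?thesis using j arc_cone_add_arc[OF j(2) b(2)] by metis
    qed
  qed
qed

lemma M_convex_iff:
  "M_convex S \<longleftrightarrow> S \<noteq> {} \<and> (\<forall>x\<in>S. \<forall>y\<in>S. \<forall>i. y $ i < x $ i \<longrightarrow>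
     (\<exists>j. x $ j < y $ j \<and> x + unit_diff j i \<in> S \<and> y + unit_diff i j \<in> S))"
proof -
  have "x - axis i 1 + axis j 1 = x + unit_diff j i" "x + axis i 1 - axis j 1 = x + unit_diff i j"
    for x :: "int ^ 'a" and i j
    by (simp_all add: unit_diff_def)
  then show ?thesis by (simp only: M_convex_def)
qed

lemma Mnat_convex_iff:
  "Mnat_convex S \<longleftrightarrow> S \<noteq> {} \<and> (\<forall>x\<in>S. \<forall>y\<in>S. \<forall>i. y $ i < x $ i \<longrightarrow>
     (x - axis i 1 \<in> S \<and> y + axis i 1 \<in> S) \<or>
     (\<exists>j. x $ j < y $ j \<and> x + unit_diff j i \<in> S \<and> y + unit_diff i j \<in> S))"
proof -
  have "x - axis i 1 + axis j 1 = x + unit_diff j i" "x + axis i 1 - axis j 1 = x + unit_diff i j"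
    for x :: "int ^ 'a" and i j
    by (simp_all add: unit_diff_def)
  then show ?thesis by (simp only: Mnat_convex_def)
qed

lemma M_convex_arc_cone: "M_convex (arc_cone E)"
  unfolding M_convex_iff
proof (intro conjI ballI allI impI)
  show "arc_cone E \<noteq> {}" using arc_cone_zero by blast
  fix x y i assume "x \<in> arc_cone E" "y \<in> arc_cone E" and i: "y $ i < x $ i"
  then obtain m n where "arc_sum E m x" "arc_sum E n y" by (auto simp: arc_cone_def)
  then show "\<exists>j. x $ j < y $ j \<and> x + unit_diff j i \<in> arc_cone E \<and> y + unit_diff i j \<in> arc_cone E"
    using i by (rule arc_cone_exchange)
qed

section \<open>Membership in an arc cone\<close>

definition arc_closed :: "('v \<times> 'v) set \<Rightarrow> 'v set \<Rightarrow> bool" where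
  "arc_closed E I \<longleftrightarrow> (\<forall>i\<in>I. \<forall>j. (i, j) \<in> E \<longrightarrow> j \<in> I)"

text \<open>A feasibility criterion of Gale type. With \<open>U\<close> the largest tight closed set avoiding \<open>i\<close>,
  reducing \<open>d\<close> along an arc from \<open>i\<close> to a point outside \<open>U\<close> violates none of the inequalities.\<close>

lemma arc_cone_memI:
  fixes d :: "int ^ 'v"
  assumes refl: "\<And>i. (i, i) \<in> E" and trans: "\<And>i j k. (i, j) \<in> E \<Longrightarrow> (j, k) \<in> E \<Longrightarrow> (i, k) \<in> E"
    and "(\<Sum>k\<in>UNIV. d $ k) = 0" and "\<And>I. arc_closed E I \<Longrightarrow> (\<Sum>k\<in>I. d $ k) \<le> 0"
  shows "d \<in> arc_cone E"
  using assms(3,4)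
proof (induction "vdist d 0" arbitrary: d rule: less_induct)
  case less
  show ?case
  proof (cases "d = 0")
    case True
    then show ?thesis by (simp add: arc_cone_zero)
  next
    case False
    have "\<exists>i. 0 < d $ i"
    proof (rule ccontr)
      assume "\<not> ?thesis"
      then have nonpos: "\<forall>k\<in>UNIV. d $ k \<le> 0" by (auto simp: not_less)
      then have "\<forall>k\<in>UNIV. d $ k = 0"
        using less.prems(1) sum_nonneg_eq_0_iff[of UNIV "\<lambda>k. - d $ k"] by (simp add: sum_negf)
      then show False using False by (simp add: vec_eq_iff)
    qed
    then obtain i where i: "0 < d $ i" by blast
    define tight where "tight I \<longleftrightarrow> arc_closed E I \<and> i \<notin> I \<and> (\<Sum>k\<in>I. d $ k) = 0" for I
    \<comment> \<open>The sums over union and intersection add up to 0 and neither is positive, so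
      both vanish.\<close>
    have Un: "tight (I \<union> J)" if "tight I" "tight J" for I J
    proof -
      have cl: "arc_closed E (I \<union> J)" "arc_closed E (I \<inter> J)"
        using that by (auto simp: tight_def arc_closed_def)
      have "(\<Sum>k\<in>I \<union> J. d $ k) + (\<Sum>k\<in>I \<inter> J. d $ k) = 0"
        using that sum.union_inter[of I J "\<lambda>k. d $ k"] by (simp add: tight_def)
      then show ?thesis
        using less.prems(2)[OF cl(1)] less.prems(2)[OF cl(2)] cl(1) that by (simp add: tight_def)
    qed
    have "tight (\<Union>\<I>)" if "finite \<I>" "\<forall>I\<in>\<I>. tight I" for \<I>
      using that by (induction \<I>) (auto simp: Un, simp add: tight_def arc_closed_def)
    then have U: "tight (\<Union>{I. tight I})" by simp
    define U where "U = \<Union>{I. tight I}"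
    define R where "R = {j. (i, j) \<in> E}"
    have clR: "arc_closed E R" using trans by (auto simp: arc_closed_def R_def)
    \<comment> \<open>Otherwise the closed set \<open>R \<union> U\<close> would have sum at least
      \<open>d $ i\<close>, since \<open>U\<close> contributes 0.\<close>
    have "\<exists>j\<in>R - U. d $ j < 0"
    proof (rule ccontr)
      assume "\<not> ?thesis"
      then have nonneg: "\<And>j. j \<in> R - U \<Longrightarrow> 0 \<le> d $ j" by (auto simp: not_less)
      have "i \<in> R - U" using refl U by (auto simp: R_def U_def tight_def)
      then have "d $ i \<le> (\<Sum>k\<in>R - U. d $ k)"
        using nonneg by (intro member_le_sum) auto
      moreover have "(\<Sum>k\<in>R \<union> U. d $ k) = (\<Sum>k\<in>R - U. d $ k) + (\<Sum>k\<in>U. d $ k)"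
        by (subst sum.union_disjoint[symmetric]) auto
      moreover have "(\<Sum>k\<in>R \<union> U. d $ k) \<le> 0"
        using clR U by (intro less.prems(2)) (auto simp: arc_closed_def tight_def U_def)
      ultimately show False using i U by (simp add: tight_def U_def)
    qed
    then obtain j where j: "(i, j) \<in> E" "j \<notin> U" "d $ j < 0" by (auto simp: R_def)
    define d' where "d' = d + unit_diff j i"
    have sum: "(\<Sum>k\<in>I. d' $ k) = (\<Sum>k\<in>I. d $ k) + (if j \<in> I then 1 else 0) - (if i \<in> I then 1 else 0)" for I
      by (simp add: d'_def sum.distrib sum_unit_diff)
    have "vdist d' 0 < vdist d 0"
      unfolding d'_def using i j(3) by (intro vdist_step) auto
    moreover have "(\<Sum>k\<in>UNIV. d' $ k) = 0" using less.prems(1) sum[of UNIV] by simp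
    \<comment> \<open>Only sets containing \<open>j\<close> but not \<open>i\<close> gain, and they
      gain 1. Tight sets lie in \<open>U\<close> and miss \<open>j\<close>; closed sets that avoid
      \<open>i\<close> and are not tight have sum at most -1.\<close>
    moreover have "(\<Sum>k\<in>I. d' $ k) \<le> 0" if "arc_closed E I" for I
    proof (cases "tight I")
      case True
      then have "j \<notin> I" using j(2) by (auto simp: U_def)
      then show ?thesis using sum[of I] less.prems(2)[OF that] by simp
    next
      case False
      then have "i \<in> I \<or> (\<Sum>k\<in>I. d $ k) < 0"
        using that less.prems(2)[OF that] by (auto simp: tight_def)
      then show ?thesis using sum[of I] less.prems(2)[OF that] by auto
    qed
    ultimately have "d' \<in> arc_cone E" by (rule less.hyps)
    then have "d' + unit_diff i j \<in> arc_cone E" using j(1) by (rule arc_cone_add_arc)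
    then show ?thesis by (simp add: d'_def unit_diff_def)
  qed
qed

text \<open>Sums over sets closed under free arcs serve as the functionals: they are bounded above
  on \<open>S\<close>, and with the constant total their nonincrease puts an increment into the arc
  cone.\<close>

lemma weak_exchange_good_direction_set:
  fixes S :: "(int ^ 'v) set"
  assumes S: "weak_exchange S"
  shows "good_direction_set S (arc_cone (free_arcs S))"
  unfolding good_direction_set_def
proof (intro conjI ballI allI impI)
  show "submonoid (arc_cone (free_arcs S))" by (rule submonoid_arc_cone)
next
  fix x g assume x: "x \<in> S" and "g \<in> arc_cone (free_arcs S)"
  then obtain n where "arc_sum (free_arcs S) n g" by (auto simp: arc_cone_def)
  then show "x + g \<in> S"
    by induction (use x in \<open>auto simp: free_arcs_def add.assoc[symmetric]\<close>)
next
  fix f :: "nat \<Rightarrow> int ^ 'v" assume f: "range f \<subseteq> S"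
  have "\<exists>\<phi> :: nat \<Rightarrow> nat. strict_mono \<phi> \<and> (\<forall>I\<in>{I. arc_closed (free_arcs S) I}. \<forall>k l. k < l \<longrightarrow>
      (\<Sum>i\<in>I. f (\<phi> l) $ i) \<le> (\<Sum>i\<in>I. f (\<phi> k) $ i))"
  proof (rule common_decseq_subsequence[OF _ _ f])
    show "\<exists>b. \<forall>x\<in>S. (\<Sum>i\<in>I. x $ i) \<le> b" if "I \<in> {I. arc_closed (free_arcs S) I}" for I
      using that by (intro closed_set_sum_bounded[OF S]) (auto simp: arc_closed_def)
  qed simp
  then obtain \<phi> :: "nat \<Rightarrow> nat" where \<phi>: "strict_mono \<phi>" "\<And>I k l. arc_closed (free_arcs S) I \<Longrightarrow> k < l \<Longrightarrow>
      (\<Sum>i\<in>I. f (\<phi> l) $ i) \<le> (\<Sum>i\<in>I. f (\<phi> k) $ i)" by auto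
  have "f (\<phi> l) - f (\<phi> k) \<in> arc_cone (free_arcs S)" if "k < l" for k l
  proof (rule arc_cone_memI[OF free_arcs_refl free_arcs_trans])
    show "(\<Sum>i\<in>UNIV. (f (\<phi> l) - f (\<phi> k)) $ i) = 0"
      using weak_exchange_sum_eq[OF S, of "f (\<phi> l)" "f (\<phi> k)"] f by (auto simp: sum_subtractf)
    show "(\<Sum>i\<in>I. (f (\<phi> l) - f (\<phi> k)) $ i) \<le> 0" if "arc_closed (free_arcs S) I" for I
      using \<phi>(2)[OF that \<open>k < l\<close>] by (simp add: sum_subtractf)
  qed
  then show "\<exists>\<phi> :: nat \<Rightarrow> nat. strict_mono \<phi> \<and> (\<forall>k l. k < l \<longrightarrow> f (\<phi> l) - f (\<phi> k) \<in> arc_cone (free_arcs S))"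
    using \<phi>(1) by blast
qed

section \<open>M-convex sets, and intersections with boxes\<close>

lemma M_convex_sum_eq:
  assumes S: "M_convex S" and "x \<in> S" "y \<in> S"
  shows "(\<Sum>k\<in>UNIV. x $ k) = (\<Sum>k\<in>UNIV. y $ k)"
  using assms(2,3)
proof (induction "vdist x y" arbitrary: x y rule: less_induct)
  case less
  \<comment> \<open>One orientation is proved with the induction hypothesis as an assumption, so
    that it also applies with the two points interchanged.\<close>
  have *: "(\<Sum>k\<in>UNIV. x $ k) = (\<Sum>k\<in>UNIV. y $ k)"
    if xyi: "x \<in> S" "y \<in> S" "y $ i < x $ i" and IH: "\<And>x' y'. vdist x' y' < vdist x y \<Longrightarrow> x' \<in> S \<Longrightarrow> y' \<in> S \<Longrightarrow>
      (\<Sum>k\<in>UNIV. x' $ k) = (\<Sum>k\<in>UNIV. y' $ k)" for x y i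
  proof -
    obtain j where j: "x $ j < y $ j" "x + unit_diff j i \<in> S"
      using S xyi unfolding M_convex_iff by blast
    then have "(\<Sum>k\<in>UNIV. (x + unit_diff j i) $ k) = (\<Sum>k\<in>UNIV. y $ k)"
      using xyi by (intro IH vdist_step) auto
    then show ?thesis by (simp add: sum.distrib sum_unit_diff)
  qed
  show ?case
  proof (cases "x = y")
    case False
    then obtain i where "x $ i \<noteq> y $ i" by (auto simp: vec_eq_iff)
    then consider "y $ i < x $ i" | "x $ i < y $ i" by linarith
    then show ?thesis
    proof cases
      case 1
      show ?thesis by (rule *[OF less.prems 1 less.hyps])
    next
      case 2
      have "(\<Sum>k\<in>UNIV. y $ k) = (\<Sum>k\<in>UNIV. x $ k)"
        by (rule *[OF less.prems(2,1) 2]) (rule less.hyps, simp_all add: vdist_commute[of x y])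
      then show ?thesis ..
    qed
  qed simp
qed

lemma M_convex_weak_exchange: "M_convex S \<Longrightarrow> weak_exchange S"
  unfolding weak_exchange_def using M_convex_sum_eq by (metis M_convex_iff)

lemma M_convex_good_direction_set:
  assumes "M_convex S"
  shows "\<exists>G. M_convex G \<and> good_direction_set S G"
  using weak_exchange_good_direction_set[OF M_convex_weak_exchange[OF assms]] M_convex_arc_cone
  by blast

lemma M_convex_Int_order_convex:
  assumes S: "M_convex S" and B: "order_convex B" and ne: "S \<inter> B \<noteq> {}"
  shows "M_convex (S \<inter> B)"
  unfolding M_convex_iff
proof (intro conjI ballI allI impI)
  fix x y i assume x: "x \<in> S \<inter> B" and y: "y \<in> S \<inter> B" and i: "y $ i < x $ i"
  then obtain j where j: "x $ j < y $ j" "x + unit_diff j i \<in> S" "y + unit_diff i j \<in> S"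
    using S unfolding M_convex_iff by blast
  have "x + unit_diff j i \<in> B" "y + unit_diff i j \<in> B"
    using x y i j by (auto intro!: order_convexD[OF B, of x y] simp: unit_diff_nth)
  with j show "\<exists>j. x $ j < y $ j \<and> x + unit_diff j i \<in> S \<inter> B \<and> y + unit_diff i j \<in> S \<inter> B" by blast
qed (rule ne)

lemma Mnat_convex_Int_order_convex:
  assumes S: "Mnat_convex S" and B: "order_convex B" and ne: "S \<inter> B \<noteq> {}"
  shows "Mnat_convex (S \<inter> B)"
  unfolding Mnat_convex_iff
proof (intro conjI ballI allI impI)
  fix x y i assume x: "x \<in> S \<inter> B" and y: "y \<in> S \<inter> B" and i: "y $ i < x $ i"
  then consider "x - axis i 1 \<in> S" "y + axis i 1 \<in> S"
    | j where "x $ j < y $ j" "x + unit_diff j i \<in> S" "y + unit_diff i j \<in> S"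
    using S unfolding Mnat_convex_iff by blast
  then show "(x - axis i 1 \<in> S \<inter> B \<and> y + axis i 1 \<in> S \<inter> B) \<or>
     (\<exists>j. x $ j < y $ j \<and> x + unit_diff j i \<in> S \<inter> B \<and> y + unit_diff i j \<in> S \<inter> B)"
  proof cases
    case 1
    have "x - axis i 1 \<in> B" "y + axis i 1 \<in> B"
      using x y i by (auto intro!: order_convexD[OF B, of x y] simp: axis_def)
    with 1 show ?thesis by blast
  next
    case 2
    have "x + unit_diff j i \<in> B" "y + unit_diff i j \<in> B"
      using x y i 2 by (auto intro!: order_convexD[OF B, of x y] simp: unit_diff_nth)
    with 2 show ?thesis by blast
  qed
qed (rule ne)

section \<open>M-natural-convex sets\<close>

text \<open>Exchanging \<open>q\<close> against \<open>p\<close> where \<open>q\<close> is larger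
  either lowers \<open>q\<close> by a unit vector, as wanted, or moves \<open>p\<close> towards
  \<open>q\<close> with its total unchanged, and induction applies.\<close>

lemma Mnat_convex_shrink:
  assumes S: "Mnat_convex S" and "p \<in> S" "q \<in> S" "(\<Sum>k\<in>UNIV. p $ k) < (\<Sum>k\<in>UNIV. q $ k)"
  obtains l where "p $ l < q $ l" "q - axis l 1 \<in> S"
proof -
  have "\<exists>l. p $ l < q $ l \<and> q - axis l 1 \<in> S"
    using assms(2,4)
  proof (induction "vdist p q" arbitrary: p rule: less_induct)
    case less
    have "\<not> (\<forall>i\<in>UNIV. q $ i \<le> p $ i)" using less.prems(2) sum_mono[of UNIV "($) q" "($) p"] by auto
    then obtain i where i: "p $ i < q $ i" by (auto simp: not_le)
    then consider "q - axis i 1 \<in> S"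
      | j where "q $ j < p $ j" "p + unit_diff i j \<in> S"
      using S \<open>q \<in> S\<close> less.prems(1) unfolding Mnat_convex_iff by blast
    then show ?case
    proof cases
      case 1
      with i show ?thesis by blast
    next
      case 2
      have "vdist (p + unit_diff i j) q < vdist p q" using i 2 by (intro vdist_step)
      moreover have "(\<Sum>k\<in>UNIV. (p + unit_diff i j) $ k) < (\<Sum>k\<in>UNIV. q $ k)"
        using less.prems(2) by (simp add: sum.distrib sum_unit_diff)
      ultimately obtain l where l: "(p + unit_diff i j) $ l < q $ l" "q - axis l 1 \<in> S"
        using less.hyps 2(2) by blast
      \<comment> \<open>The new \<open>p\<close> is lower than the old one only at \<open>j\<close>,
        where it is still at least \<open>q $ j\<close>; so \<open>l \<noteq> j\<close>.\<close>
      have "p $ l < q $ l" using l(1) 2(1) by (auto simp: unit_diff_nth split: if_splits)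
      with l show ?thesis by blast
    qed
  qed
  then show thesis using that by blast
qed

text \<open>The mirror image: now \<open>q\<close> moves towards \<open>p\<close> until an exchange
  adds a unit vector to \<open>p\<close>.\<close>

lemma Mnat_convex_grow:
  assumes S: "Mnat_convex S" and "p \<in> S" "q \<in> S" "(\<Sum>k\<in>UNIV. p $ k) < (\<Sum>k\<in>UNIV. q $ k)"
  obtains l where "p $ l < q $ l" "p + axis l 1 \<in> S"
proof -
  have "\<exists>l. p $ l < q $ l \<and> p + axis l 1 \<in> S"
    using assms(3,4)
  proof (induction "vdist q p" arbitrary: q rule: less_induct)
    case less
    have "\<not> (\<forall>i\<in>UNIV. q $ i \<le> p $ i)" using less.prems(2) sum_mono[of UNIV "($) q" "($) p"] by auto
    then obtain i where i: "p $ i < q $ i" by (auto simp: not_le)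
    then consider "p + axis i 1 \<in> S"
      | j where "q $ j < p $ j" "q + unit_diff j i \<in> S"
      using S \<open>p \<in> S\<close> less.prems(1) unfolding Mnat_convex_iff by blast
    then show ?case
    proof cases
      case 1
      with i show ?thesis by blast
    next
      case 2
      have "vdist (q + unit_diff j i) p < vdist q p" using i 2 by (intro vdist_step)
      moreover have "(\<Sum>k\<in>UNIV. p $ k) < (\<Sum>k\<in>UNIV. (q + unit_diff j i) $ k)"
        using less.prems(2) by (simp add: sum.distrib sum_unit_diff)
      ultimately obtain l where l: "p $ l < (q + unit_diff j i) $ l" "p + axis l 1 \<in> S"
        using less.hyps 2(2) by blast
      have "p $ l < q $ l" using l(1) 2(1) by (auto simp: unit_diff_nth split: if_splits)
      with l show ?thesis by blast
    qed
  qed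
  then show thesis using that by blast
qed

text \<open>The new coordinate fixes the total at 0, so steps by one unit vector become exchanges
  with \<open>None\<close>.\<close>

definition lift_vec :: "int ^ 'n \<Rightarrow> int ^ 'n option" where
  "lift_vec x = (\<chi> k. case k of None \<Rightarrow> - (\<Sum>i\<in>UNIV. x $ i) | Some i \<Rightarrow> x $ i)"

definition drop_vec :: "int ^ 'n option \<Rightarrow> int ^ 'n" where
  "drop_vec x = (\<chi> i. x $ Some i)"

lemma lift_vec_nth [simp]:
  "lift_vec x $ None = - (\<Sum>i\<in>UNIV. x $ i)" "lift_vec x $ Some i = x $ i"
  by (simp_all add: lift_vec_def)

lemma drop_vec_nth [simp]: "drop_vec x $ i = x $ Some i"
  by (simp add: drop_vec_def)

lemma drop_lift_vec [simp]: "drop_vec (lift_vec x) = x"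
  by (simp add: vec_eq_iff)

lemma drop_vec_add: "drop_vec (x + y) = drop_vec x + drop_vec y"
  and drop_vec_diff: "drop_vec (x - y) = drop_vec x - drop_vec y"
  by (simp_all add: vec_eq_iff)

lemma sum_lift_vec: "(\<Sum>k\<in>UNIV. lift_vec x $ k) = 0"
  by (simp add: UNIV_option_conv sum.reindex)

lemma sum_axis: "(\<Sum>k\<in>UNIV. axis i (1::int) $ k) = 1"
  by (simp add: axis_def)

lemma lift_vec_unit_diff:
  "lift_vec x + unit_diff (Some i) (Some j) = lift_vec (x + unit_diff i j)"
  "lift_vec x + unit_diff None (Some i) = lift_vec (x - axis i 1)"
  "lift_vec x + unit_diff (Some i) None = lift_vec (x + axis i 1)"
  unfolding vec_eq_iff
  by (auto simp: lift_vec_def sum.distrib sum_subtractf sum_unit_diff sum_axis unit_diff_nth axis_def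
      split: option.split)

lemma drop_vec_unit_diff:
  "drop_vec (unit_diff (Some i) (Some j)) = unit_diff i j"
  "drop_vec (unit_diff None (Some i)) = - axis i 1"
  "drop_vec (unit_diff (Some i) None) = axis i 1"
  by (simp_all add: vec_eq_iff unit_diff_nth axis_def)

text \<open>A unit step becomes an exchange with \<open>None\<close> when the totals allow it.
  Otherwise, and when the given coordinate is \<open>None\<close> itself, growing and shrinking each
  supply a partner; these may differ, hence the weak form.\<close>

lemma weak_exchange_lift_vec:
  assumes S: "Mnat_convex S"
  shows "weak_exchange (lift_vec ` S)"
  unfolding weak_exchange_def
proof (intro conjI ballI allI impI)
  fix X Y assume "X \<in> lift_vec ` S" "Y \<in> lift_vec ` S"
  then obtain x y where xy: "X = lift_vec x" "Y = lift_vec y" "x \<in> S" "y \<in> S" by blast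
  show "(\<Sum>k\<in>UNIV. X $ k) = (\<Sum>k\<in>UNIV. Y $ k)" by (simp add: xy sum_lift_vec)
  fix k assume k: "Y $ k < X $ k"
  have "(\<exists>j. X $ j < Y $ j \<and> X + unit_diff j k \<in> lift_vec ` S) \<and>
      (\<exists>j. X $ j < Y $ j \<and> Y + unit_diff k j \<in> lift_vec ` S)"
  proof (cases k)
    case None
    then have less: "(\<Sum>i\<in>UNIV. x $ i) < (\<Sum>i\<in>UNIV. y $ i)" using k by (simp add: xy)
    obtain l where "x $ l < y $ l" "x + axis l 1 \<in> S"
      using Mnat_convex_grow[OF S xy(3,4) less] .
    moreover obtain l' where "x $ l' < y $ l'" "y - axis l' 1 \<in> S"
      using Mnat_convex_shrink[OF S xy(3,4) less] .
    ultimately show ?thesis unfolding None xy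
      by (metis imageI lift_vec_nth(2) lift_vec_unit_diff(2,3))
  next
    case (Some i)
    then have i: "y $ i < x $ i" using k by (simp add: xy)
    then consider "x - axis i 1 \<in> S" "y + axis i 1 \<in> S"
      | j where "x $ j < y $ j" "x + unit_diff j i \<in> S" "y + unit_diff i j \<in> S"
      using S xy(3,4) unfolding Mnat_convex_iff by blast
    then show ?thesis
    proof cases
      case 1
      show ?thesis
      \<comment> \<open>If the total of \<open>x\<close> is at most that of \<open>y\<close>, a unit
        step on either side makes the gap strict, and a partner restores the total. Otherwise
        \<open>None\<close> is a valid partner.\<close>
      proof (cases "(\<Sum>i\<in>UNIV. x $ i) \<le> (\<Sum>i\<in>UNIV. y $ i)")
        case True
        then have "(\<Sum>k\<in>UNIV. (x - axis i 1) $ k) < (\<Sum>k\<in>UNIV. y $ k)"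
          by (simp add: sum_subtractf sum_axis)
        from Mnat_convex_grow[OF S 1(1) xy(4) this] obtain l
          where l: "(x - axis i 1) $ l < y $ l" "x - axis i 1 + axis l 1 \<in> S" .
        have "(\<Sum>k\<in>UNIV. x $ k) < (\<Sum>k\<in>UNIV. (y + axis i 1) $ k)"
          using True by (simp add: sum.distrib sum_axis)
        from Mnat_convex_shrink[OF S xy(3) 1(2) this] obtain l'
          where l': "x $ l' < (y + axis i 1) $ l'" "y + axis i 1 - axis l' 1 \<in> S" .
        \<comment> \<open>Since \<open>y $ i < x $ i\<close>, one unit cannot reverse the order at
          \<open>i\<close>, so neither \<open>l\<close> nor \<open>l'\<close> is
          \<open>i\<close>.\<close>
        have "x $ l < y $ l" using l(1) i by (auto simp: axis_def split: if_splits)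
        moreover have "x $ l' < y $ l'" using l'(1) i by (auto simp: axis_def split: if_splits)
        moreover have "x + unit_diff l i \<in> S" "y + unit_diff i l' \<in> S"
          using l(2) l'(2) by (simp_all add: unit_diff_def algebra_simps)
        ultimately show ?thesis unfolding Some xy
          by (metis imageI lift_vec_nth(2) lift_vec_unit_diff(1))
      next
        case False
        then have "X $ None < Y $ None" by (simp add: xy)
        then show ?thesis using 1 unfolding Some xy
          by (metis imageI lift_vec_unit_diff(2,3))
      qed
    next
      case 2
      then show ?thesis unfolding Some xy by (metis imageI lift_vec_nth(2) lift_vec_unit_diff(1))
    qed
  qed
  then show "\<exists>j. X $ j < Y $ j \<and> X + unit_diff j k \<in> lift_vec ` S"
    "\<exists>j. X $ j < Y $ j \<and> Y + unit_diff k j \<in> lift_vec ` S" by blast+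
qed

lemma Mnat_convex_drop_vec:
  assumes C: "M_convex C"
  shows "Mnat_convex (drop_vec ` C)"
  unfolding Mnat_convex_iff
proof (intro conjI ballI allI impI)
  show "drop_vec ` C \<noteq> {}" using C by (simp add: M_convex_def)
  fix x y i assume "x \<in> drop_vec ` C" "y \<in> drop_vec ` C" and i: "y $ i < x $ i"
  then obtain X Y where XY: "x = drop_vec X" "y = drop_vec Y" "X \<in> C" "Y \<in> C" by blast
  then have "Y $ Some i < X $ Some i" using i by simp
  then obtain k where k: "X $ k < Y $ k" "X + unit_diff k (Some i) \<in> C" "Y + unit_diff (Some i) k \<in> C"
    using C XY unfolding M_convex_iff by blast
  then have mem: "x + drop_vec (unit_diff k (Some i)) \<in> drop_vec ` C"
    "y + drop_vec (unit_diff (Some i) k) \<in> drop_vec ` C"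
    by (metis XY(1) drop_vec_add imageI) (metis XY(2) drop_vec_add imageI k(3))
  show "(x - axis i 1 \<in> drop_vec ` C \<and> y + axis i 1 \<in> drop_vec ` C) \<or>
     (\<exists>j. x $ j < y $ j \<and> x + unit_diff j i \<in> drop_vec ` C \<and> y + unit_diff i j \<in> drop_vec ` C)"
  proof (cases k)
    case None
    then show ?thesis using mem by (simp add: drop_vec_unit_diff)
  next
    case (Some j)
    then have "x $ j < y $ j" using k(1) XY by simp
    then show ?thesis using mem Some by (auto simp: drop_vec_unit_diff)
  qed
qed

lemma submonoid_image:
  assumes "submonoid G" "f 0 = 0" "\<And>x y. f (x + y) = f x + f y"
  shows "submonoid (f ` G)"
  using assms(1) unfolding submonoid_def
  by (auto simp: assms(3)[symmetric] intro: image_eqI[of 0 f 0] simp: assms(2))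

text \<open>Weak exchange of the lifting yields the direction set; the arc cone is itself M-convex,
  and dropping the extra coordinate makes it M-natural-convex.\<close>

lemma Mnat_convex_good_direction_set:
  fixes S :: "(int ^ 'n) set"
  assumes S: "Mnat_convex S"
  shows "\<exists>G. Mnat_convex G \<and> good_direction_set S G"
proof -
  define C where "C = arc_cone (free_arcs (lift_vec ` S))"
  have good: "good_direction_set (lift_vec ` S) C"
    unfolding C_def by (rule weak_exchange_good_direction_set[OF weak_exchange_lift_vec[OF S]])
  have "Mnat_convex (drop_vec ` C)"
    unfolding C_def by (rule Mnat_convex_drop_vec[OF M_convex_arc_cone])
  moreover have "good_direction_set S (drop_vec ` C)"
    unfolding good_direction_set_def
  proof (intro conjI ballI allI impI)
    show "submonoid (drop_vec ` C)"
      using good unfolding good_direction_set_def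
      by (intro submonoid_image) (auto simp: drop_vec_add, simp add: vec_eq_iff)
  next
    fix x g assume "x \<in> S" "g \<in> drop_vec ` C"
    then obtain X where X: "g = drop_vec X" "X \<in> C" by blast
    then have "lift_vec x + X \<in> lift_vec ` S"
      using good \<open>x \<in> S\<close> unfolding good_direction_set_def by blast
    then show "x + g \<in> S"
      by (metis X(1) drop_lift_vec drop_vec_add imageE)
  next
    fix f :: "nat \<Rightarrow> int ^ 'n" assume "range f \<subseteq> S"
    then have "range (\<lambda>n. lift_vec (f n)) \<subseteq> lift_vec ` S" by auto
    from good_direction_set_subsequence[OF good this] obtain \<phi> :: "nat \<Rightarrow> nat"
      where \<phi>: "strict_mono \<phi>" "\<And>k l. k < l \<Longrightarrow> lift_vec (f (\<phi> l)) - lift_vec (f (\<phi> k)) \<in> C" by blast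
    then have "f (\<phi> l) - f (\<phi> k) \<in> drop_vec ` C" if "k < l" for k l
      using that by (metis drop_lift_vec drop_vec_diff imageI)
    with \<phi>(1) show "\<exists>\<phi> :: nat \<Rightarrow> nat. strict_mono \<phi> \<and> (\<forall>k l. k < l \<longrightarrow> f (\<phi> l) - f (\<phi> k) \<in> drop_vec ` C)"
      by blast
  qed
  ultimately show ?thesis by blast
qed

section \<open>The decomposition theorems\<close>

lemma decomposition_if_good_direction_set:
  fixes S G :: "(int ^ 'n) set"
  assumes "good_direction_set S G" "S \<noteq> {}" "P G"
    and "\<And>B. order_convex B \<Longrightarrow> S \<inter> B \<noteq> {} \<Longrightarrow> P (S \<inter> B)"
  shows "\<exists>T G. finite T \<and> P T \<and> submonoid G \<and> P G \<and> S = T + G"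
proof -
  obtain B where "order_convex B" "finite B" "S \<inter> B \<noteq> {}" "S = (S \<inter> B) + G"
    using bounded_decomposition[OF assms(1,2)] by blast
  moreover have "submonoid G" using assms(1) by (simp add: good_direction_set_def)
  ultimately show ?thesis using assms(3,4) by (metis finite_Int)
qed

lemma Lnat_convex_decomposition:
  assumes "Lnat_convex S"
  shows "\<exists>T G. finite T \<and> Lnat_convex T \<and> submonoid G \<and> Lnat_convex G \<and> S = T + G"
proof -
  obtain G where "Lnat_convex G" "good_direction_set S G"
    using Lnat_convex_good_direction_set[OF assms] by blast
  then show ?thesis
    using assms Lnat_convex_Int_order_convex[OF assms]
    by (intro decomposition_if_good_direction_set) (auto simp: Lnat_convex_def)
qed

lemma L2nat_convex_decomposition:
  assumes "L2nat_convex S"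
  shows "\<exists>T G. finite T \<and> L2nat_convex T \<and> submonoid G \<and> L2nat_convex G \<and> S = T + G"
proof -
  obtain A B where AB: "Lnat_convex A" "Lnat_convex B" "S = A + B"
    using assms by (auto simp: L2nat_convex_def)
  obtain T G where T: "finite T" "Lnat_convex T" "submonoid G" "Lnat_convex G" "A = T + G"
    using Lnat_convex_decomposition[OF AB(1)] by blast
  obtain U H where U: "finite U" "Lnat_convex U" "submonoid H" "Lnat_convex H" "B = U + H"
    using Lnat_convex_decomposition[OF AB(2)] by blast
  have "S = (T + U) + (G + H)" by (simp add: AB T U ac_simps)
  moreover have "finite (T + U)" using T U by (simp add: finite_set_plus)
  moreover have "submonoid (G + H)" using T U submonoid_plus by blast
  ultimately show ?thesis using T U unfolding L2nat_convex_def by blast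
qed

lemma Mnat_convex_decomposition:
  assumes "Mnat_convex S"
  shows "\<exists>T G. finite T \<and> Mnat_convex T \<and> submonoid G \<and> Mnat_convex G \<and> S = T + G"
proof -
  obtain G where "Mnat_convex G" "good_direction_set S G"
    using Mnat_convex_good_direction_set[OF assms] by blast
  then show ?thesis
    using assms Mnat_convex_Int_order_convex[OF assms]
    by (intro decomposition_if_good_direction_set) (auto simp: Mnat_convex_def)
qed

lemma M_convex_decomposition:
  assumes "M_convex S"
  shows "\<exists>T G. finite T \<and> M_convex T \<and> submonoid G \<and> M_convex G \<and> S = T + G"
proof -
  obtain G where "M_convex G" "good_direction_set S G"
    using M_convex_good_direction_set[OF assms] by blast
  then show ?thesis
    using assms M_convex_Int_order_convex[OF assms]
    by (intro decomposition_if_good_direction_set) (auto simp: M_convex_def)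
qed

text \<open>The direction sets are intersected before a cube is chosen; the same cube then cuts
  \<open>A\<close> and \<open>B\<close>, which exhibits the finite part as an intersection of the
  required form.\<close>

lemma M2nat_convex_decomposition:
  assumes "M2nat_convex S"
  shows "\<exists>T G. finite T \<and> M2nat_convex T \<and> submonoid G \<and> M2nat_convex G \<and> S = T + G"
proof -
  obtain A B where AB: "Mnat_convex A" "Mnat_convex B" "S = A \<inter> B" "S \<noteq> {}"
    using assms by (auto simp: M2nat_convex_def)
  obtain G where G: "Mnat_convex G" "good_direction_set A G"
    using Mnat_convex_good_direction_set[OF AB(1)] by blast
  obtain H where H: "Mnat_convex H" "good_direction_set B H"
    using Mnat_convex_good_direction_set[OF AB(2)] by blast
  have good: "good_direction_set S (G \<inter> H)"
    unfolding AB(3) by (rule good_direction_set_Int[OF G(2) H(2)])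
  show ?thesis
  proof (rule decomposition_if_good_direction_set[OF good AB(4)])
    have "0 \<in> G \<inter> H" using good by (auto simp: good_direction_set_def submonoid_def)
    then show "M2nat_convex (G \<inter> H)" using G(1) H(1) unfolding M2nat_convex_def by blast
    fix C :: "(int ^ 'a) set" assume C: "order_convex C" "S \<inter> C \<noteq> {}"
    then have "Mnat_convex (A \<inter> C)" "Mnat_convex (B \<inter> C)"
      using AB by (auto intro!: Mnat_convex_Int_order_convex)
    moreover have "S \<inter> C = (A \<inter> C) \<inter> (B \<inter> C)" using AB(3) by blast
    ultimately show "M2nat_convex (S \<inter> C)" using C(2) unfolding M2nat_convex_def by blast
  qed
qed

lemma M2_convex_decomposition:
  assumes "M2_convex S"
  shows "\<exists>T G. finite T \<and> M2_convex T \<and> submonoid G \<and> M2_convex G \<and> S = T + G"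
proof -
  obtain A B where AB: "M_convex A" "M_convex B" "S = A \<inter> B" "S \<noteq> {}"
    using assms by (auto simp: M2_convex_def)
  obtain G where G: "M_convex G" "good_direction_set A G"
    using M_convex_good_direction_set[OF AB(1)] by blast
  obtain H where H: "M_convex H" "good_direction_set B H"
    using M_convex_good_direction_set[OF AB(2)] by blast
  have good: "good_direction_set S (G \<inter> H)"
    unfolding AB(3) by (rule good_direction_set_Int[OF G(2) H(2)])
  show ?thesis
  proof (rule decomposition_if_good_direction_set[OF good AB(4)])
    have "0 \<in> G \<inter> H" using good by (auto simp: good_direction_set_def submonoid_def)
    then show "M2_convex (G \<inter> H)" using G(1) H(1) unfolding M2_convex_def by blast
    fix C :: "(int ^ 'a) set" assume C: "order_convex C" "S \<inter> C \<noteq> {}"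
    then have "M_convex (A \<inter> C)" "M_convex (B \<inter> C)"
      using AB by (auto intro!: M_convex_Int_order_convex)
    moreover have "S \<inter> C = (A \<inter> C) \<inter> (B \<inter> C)" using AB(3) by blast
    ultimately show "M2_convex (S \<inter> C)" using C(2) unfolding M2_convex_def by blast
  qed
qed

lemma multimodular_decomposition:
  assumes "multimodular S"
  shows "\<exists>T G. finite T \<and> multimodular T \<and> submonoid G \<and> multimodular G \<and> S = T + G"
proof -
  let ?D = "\<lambda>y. D_matrix *v y"
  obtain A where A: "Lnat_convex A" "S = ?D ` A"
    using assms by (auto simp: multimodular_def)
  obtain T G where T: "finite T" "Lnat_convex T" "submonoid G" "Lnat_convex G" "A = T + G"
    using Lnat_convex_decomposition[OF A(1)] by blast
  have "S = ?D ` T + ?D ` G"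
    unfolding A(2) T(5) set_plus_image by (force simp: matrix_vector_right_distrib image_iff)
  moreover have "submonoid (?D ` G)"
    using T(3) by (rule submonoid_image) (simp_all add: matrix_vector_right_distrib)
  moreover have "multimodular (?D ` T)" "multimodular (?D ` G)"
    using T unfolding multimodular_def by (auto simp: image_def)
  ultimately show ?thesis using T(1) by blast
qed

theorem theorem3p12:
  fixes S :: "(int ^ 'n::{finite,linorder}) set"
  shows
    "(Lnat_convex S \<longrightarrow>
        (\<exists>T G. finite T \<and> Lnat_convex T \<and> conic_set G \<and> Lnat_convex G \<and> S = T + G)) \<and>
     (L2nat_convex S \<longrightarrow>
        (\<exists>T G. finite T \<and> L2nat_convex T \<and> conic_set G \<and> L2nat_convex G \<and> S = T + G)) \<and>
     (Mnat_convex S \<longrightarrow>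
        (\<exists>T G. finite T \<and> Mnat_convex T \<and> conic_set G \<and> Mnat_convex G \<and> S = T + G)) \<and>
     (M_convex S \<longrightarrow>
        (\<exists>T G. finite T \<and> M_convex T \<and> conic_set G \<and> M_convex G \<and> S = T + G)) \<and>
     (M2nat_convex S \<longrightarrow>
        (\<exists>T G. finite T \<and> M2nat_convex T \<and> conic_set G \<and> M2nat_convex G \<and> S = T + G)) \<and>
     (M2_convex S \<longrightarrow>
        (\<exists>T G. finite T \<and> M2_convex T \<and> conic_set G \<and> M2_convex G \<and> S = T + G)) \<and>
     (multimodular S \<longrightarrow>
        (\<exists>T G. finite T \<and> multimodular T \<and> conic_set G \<and> multimodular G \<and> S = T + G))"
  by (intro conjI impI;
      (drule Lnat_convex_decomposition | drule L2nat_convex_decomposition |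
       drule Mnat_convex_decomposition | drule M_convex_decomposition |
       drule M2nat_convex_decomposition | drule M2_convex_decomposition |
       drule multimodular_decomposition);
      blast intro: submonoid_conic)

end
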